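(* For every integer $n\ge 2$, each of the following four integer-valued statistics is Entringerian, i.e. the underlying set has cardinality $E_n$ and for every $m\in\{1,\dots,n\}$ the number of its elements $w$ at which the statistic takes the value $m$ equals $E_n(m)$: (i) $w\mapsto \mathbf{F}\,w$ on $\mathrm{And}_n^{I}$; (ii) $w\mapsto n-\mathbf{NL}\,w$ on $\mathrm{And}_n^{I}$; (iii) $w\mapsto (n+1)-\mathbf{L}\,w$ on $\mathrm{And}_n^{II}$; (iv) $w\mapsto n-\mathbf{grn}\,w$ on $\mathrm{And}_n^{II}$.
   Context: Permutations of a finite set $Y$ of positive integers are written as words $w=x_1x_2\cdots x_n$ whose letters are the elements of $Y$; $e$ is the empty word; $\min(w)$, $\max(w)$ are the smallest and largest letters. Andr\'e permutations: the empty word and every one-letter word are Andr\'e I and Andr\'e II permutations. If $w$ is a permutation of $Y$ with $|Y|\ge 2$, write $w=v\,\min(w)\,v'$ (juxtaposition); $w$ is an Andr\'e I (resp. Andr\'e II) permutation if both $v$ and $v'$ are Andr\'e I (resp. Andr\'e II) permutations and $\max(vv')$ (resp. $\min(vv')$) is a letter of $v'$. $\mathrm{And}_n^{I}$ (resp. $\mathrm{And}_n^{II}$) is the set of Andr\'e I (resp. II) permutations of $\{1,\dots,n\}$. Statistics on $w=x_1\cdots x_n$: $\mathbf{F}\,w=x_1$ (first letter), $\mathbf{L}\,w=x_n$ (last letter), $\mathbf{NL}\,w=x_{n-1}$ (next to last letter, $n\ge2$), and $\mathbf{grn}\,w=\max\{x_{i-1},x_{i+1}\}$ where $x_i=n$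 is the maximum letter, with the convention $x_0=x_{n+1}=0$. Tangent/secant numbers $E_n$: $\sum_{n\ge0}E_n u^n/n!=\tan u+\sec u$. Entringer numbers $E_n(m)$ ($1\le m\le n$) are defined by $E_1(1)=1$, $E_n(n)=0$ for $n\ge2$, and $E_n(m+1)-E_n(m)+E_{n-1}(n-m)=0$ for $n\ge2$, $1\le m\le n-1$ (equivalently, $E_n(m)$ is the number of permutations $x_1\cdots x_n$ of $\{1,\dots,n\}$ with $x_1<x_2>x_3<x_4>\cdots$ and $x_1=m$). *)

theory Defs
  imports
    Complex_Main
    "HOL-Computational_Algebra.Formal_Power_Series"
    "HOL-Combinatorics.Multiset_Permutations"
begin

inductive andreI :: "nat list \<Rightarrow> bool" where
  andreI_Nil: "andreI []"
| andreI_single: "andreI [x]"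
| andreI_step:
    "\<lbrakk>distinct w; length w \<ge> 2; w = v @ Min (set w) # v'; andreI v; andreI v';
      Max (set (v @ v')) \<in> set v'\<rbrakk> \<Longrightarrow> andreI w"

inductive andreII :: "nat list \<Rightarrow> bool" where
  andreII_Nil: "andreII []"
| andreII_single: "andreII [x]"
| andreII_step:
    "\<lbrakk>distinct w; length w \<ge> 2; w = v @ Min (set w) # v'; andreII v; andreII v';
      Min (set (v @ v')) \<in> set v'\<rbrakk> \<Longrightarrow> andreII w"

definition AndI :: "nat \<Rightarrow> nat list set" where
  "AndI n = {w \<in> permutations_of_set {1..n}. andreI w}"

definition AndII :: "nat \<Rightarrow> nat list set" where
  "AndII n = {w \<in> permutations_of_set {1..n}. andreII w}"

text \<open>Letters are numbered from 1; positions outside the word carry the letter 0.\<close>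

definition letter :: "nat list \<Rightarrow> nat \<Rightarrow> nat" where
  "letter w i = (if 1 \<le> i \<and> i \<le> length w then w ! (i - 1) else 0)"

definition first_letter :: "nat list \<Rightarrow> nat" where
  "first_letter w = letter w 1"

definition last_letter :: "nat list \<Rightarrow> nat" where
  "last_letter w = letter w (length w)"

definition next_to_last :: "nat list \<Rightarrow> nat" where
  "next_to_last w = letter w (length w - 1)"

definition grn :: "nat list \<Rightarrow> nat" where
  "grn w = (let i = (THE i. i \<in> {1..length w} \<and> letter w i = Max (set w))
            in max (letter w (i - 1)) (letter w (i + 1)))"

definition tan_sec_number :: "nat \<Rightarrow> real" where
  "tan_sec_number n = fact n * fps_nth (fps_tan 1 + inverse (fps_cos 1)) n"

text \<open>
  The recurrence is solved for \<open>E\<^sub>n(m)\<close> and run downwards from \<open>E\<^sub>n(n)\<close>; outside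
  \<open>1 \<le> m \<le> n\<close> the value is the dummy 0. The three lemmas below are the original
  defining relations.
\<close>

function entringer :: "nat \<Rightarrow> nat \<Rightarrow> nat" where
  "entringer n m =
     (if n = 1 \<and> m = 1 then 1
      else if n \<ge> 2 \<and> 1 \<le> m \<and> m < n then entringer n (m + 1) + entringer (n - 1) (n - m)
      else 0)"
  by pat_completeness auto
termination
  by (relation "measures [\<lambda>(n, m). n, \<lambda>(n, m). n - m]") auto

declare entringer.simps [simp del]

lemma entringer_1_1: "entringer 1 1 = 1"
  by (simp add: entringer.simps)

lemma entringer_diag: "n \<ge> 2 \<Longrightarrow> entringer n n = 0"
  by (simp add: entringer.simps)

lemma entringer_rec:
  assumes "n \<ge> 2" "1 \<le> m" "m \<le> n - 1"
  shows "int (entringer n (m + 1)) - int (entringer n m) + int (entringer (n - 1) (n - m)) = 0"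
  using assms by (simp add: entringer.simps [of n m])

definition entringerian :: "nat \<Rightarrow> 'a set \<Rightarrow> ('a \<Rightarrow> int) \<Rightarrow> bool" where
  "entringerian n S f \<longleftrightarrow>
     real (card S) = tan_sec_number n \<and>
     (\<forall>m\<in>{1..n}. card {w \<in> S. f w = int m} = entringer n m)"

end

theory Submission
  imports Defs
begin

text \<open>
  Put \<open>E = tan + sec\<close>, so that \<open>E'' = E E'\<close>. The Entringer numbers have the exponential generating
  function \<open>F(x, y) = cos x E(x + y) - sin x\<close>, where \<open>x\<close> marks the letters below and \<open>y\<close> those above
  the marked letter: this \<open>F\<close> satisfies \<open>F\<^sub>x - F\<^sub>y + F(y, x) = 0\<close>, which is the defining
  recurrence. It also satisfies \<open>F\<^sub>x\<^sub>y = F E'(x + y)\<close> and \<open>F\<^sub>y\<^sub>y = F\<^sub>y E(x + y)\<close>. Splitting an Andre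
  permutation at its minimum gives the convolution recurrence encoded by the first equation for the
  first letter, and the one encoded by the second equation for the other three statistics. Words over
  arbitrary finite sets are counted, so that no standardisation of the two factors is needed.
\<close>

text \<open>The formula for F can be derived from the recurrence. Exchanging the variables shows
  that D = d/dx - d/dy sends F(x, y) to -F(y, x) and F(y, x) to F(x, y). Hence D D F = -F and F =
  cos x A(x + y) + sin x B(x + y); at x = 0, the values of F and D F give A = E from F(0, y) = E(y)
  and B = -1 from F(y, 0) = 1. The two product equations reflect the factor that does not carry the
  mark. For the first letter it is the right factor, which always holds the maximum and so is one
  letter larger, whence E'. For the other statistics it consists of freely chosen letters, whence E.
  The delicate statistic is \<open>grn\<close>: type II forces the second smallest letter to the
  right, whereas the maximum, where the statistic is read, may fall on either side.\<close>

unbundle fps_syntax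

section \<open>The generating function of the Entringer numbers\<close>

text \<open>
  A bivariate series \<open>F(x, y)\<close> is an element of \<^typ>\<open>real fps fps\<close> whose outer variable is \<open>x\<close>;
  \<open>in_x p\<close>, \<open>fps_const p\<close> and \<open>in_sum p\<close> are \<open>p(x)\<close>, \<open>p(y)\<close> and \<open>p(x + y)\<close>.
\<close>

definition fps_dy :: "real fps fps \<Rightarrow> real fps fps" where
  "fps_dy F = Abs_fps (\<lambda>i. fps_deriv (F $ i))"

definition in_x :: "real fps \<Rightarrow> real fps fps" where
  "in_x p = Abs_fps (\<lambda>i. fps_const (p $ i))"

definition in_sum :: "real fps \<Rightarrow> real fps fps" where
  "in_sum p = Abs_fps (\<lambda>i. Abs_fps (\<lambda>j. of_nat ((i + j) choose i) * p $ (i + j)))"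

lemma fps_dy_add: "fps_dy (F + G) = fps_dy F + fps_dy G"
  by (simp add: fps_dy_def fps_eq_iff distrib_left)

lemma fps_dy_diff: "fps_dy (F - G) = fps_dy F - fps_dy G"
  by (simp add: fps_dy_def fps_eq_iff right_diff_distrib)

lemma fps_dy_mult: "fps_dy (F * G) = F * fps_dy G + fps_dy F * G"
  by (rule fps_ext) (simp add: fps_dy_def fps_mult_nth fps_deriv_sum sum.distrib)

lemma fps_dy_const: "fps_dy (fps_const p) = fps_const (fps_deriv p)"
  by (rule fps_ext) (simp add: fps_dy_def)

lemma fps_dy_in_x: "fps_dy (in_x p) = 0"
  by (rule fps_ext) (simp add: fps_dy_def in_x_def)

lemma fps_deriv_in_x: "fps_deriv (in_x p) = in_x (fps_deriv p)"
  by (rule fps_ext) (simp add: in_x_def fps_of_nat[symmetric] fps_const_mult[symmetric] del: fps_const_mult of_nat_Suc)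

lemma in_sum_nth_0: "in_sum p $ 0 = p"
  by (rule fps_ext) (simp add: in_sum_def)

lemma fps_deriv_in_sum: "fps_deriv (in_sum p) = in_sum (fps_deriv p)"
proof (rule fps_ext, rule fps_ext)
  fix i j
  have "real (Suc i) * real (Suc (i + j) choose Suc i) = real (Suc (i + j)) * real ((i + j) choose i)"
    by (metis Suc_times_binomial of_nat_mult)
  thus "fps_deriv (in_sum p) $ i $ j = in_sum (fps_deriv p) $ i $ j"
    by (simp add: in_sum_def fps_of_nat[symmetric] mult.left_commute[of _ "real (Suc (i + j))"]
        flip: mult.assoc del: of_nat_Suc binomial_Suc_Suc)
qed

lemma fps_dy_in_sum: "fps_dy (in_sum p) = in_sum (fps_deriv p)"
proof (rule fps_ext, rule fps_ext)
  fix i j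
  have "Suc j * (Suc (i + j) choose i) = Suc (i + j) * ((i + j) choose i)"
    using Suc_times_binomial[of j "i + j"] binomial_symmetric[of i "Suc (i + j)"] binomial_symmetric[of i "i + j"]
    by (simp add: Suc_diff_le del: binomial_Suc_Suc)
  hence "real (Suc j) * real (Suc (i + j) choose i) = real (Suc (i + j)) * real ((i + j) choose i)"
    by (metis of_nat_mult)
  thus "fps_dy (in_sum p) $ i $ j = in_sum (fps_deriv p) $ i $ j"
    by (simp add: in_sum_def fps_dy_def mult.left_commute[of _ "real (Suc (i + j))"]
        flip: mult.assoc del: of_nat_Suc binomial_Suc_Suc)
qed

text \<open>Each coefficient of x^n is determined by the y-derivative of the one before, so a
  solution of this transport equation is fixed by its value at x = 0.\<close>

lemma fps_dx_eq_dy_imp_0: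
  assumes "fps_deriv R = fps_dy R" "R $ 0 = 0"
  shows "R = 0"
proof -
  have "R $ n = 0" for n
  proof (induction n)
    case (Suc n)
    have "of_nat (Suc n) * R $ Suc n = fps_deriv (R $ n)"
      using arg_cong[OF assms(1), of "\<lambda>F. F $ n"] by (simp add: fps_dy_def)
    thus ?case using Suc by (simp del: of_nat_Suc)
  qed (use assms in simp)
  thus ?thesis by (simp add: fps_eq_iff)
qed

text \<open>
  Along \<open>\<partial>\<^sub>x - \<partial>\<^sub>y\<close> the pair \<open>(P, R)\<close> rotates, so it vanishes once it does so on \<open>x = 0\<close>; this
  replaces the addition formulas for sine and cosine.
\<close>

lemma fps_rotation_imp_0:
  assumes "fps_deriv P - fps_dy P = R" "fps_deriv R - fps_dy R = - P" "P $ 0 = 0" "R $ 0 = 0"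
  shows "P = 0"
proof -
  have "P $ n = 0 \<and> R $ n = 0" for n
  proof (induction n)
    case (Suc n)
    have "of_nat (Suc n) * P $ Suc n - fps_deriv (P $ n) = R $ n"
      using arg_cong[OF assms(1), of "\<lambda>F. F $ n"] by (simp add: fps_dy_def)
    moreover have "of_nat (Suc n) * R $ Suc n - fps_deriv (R $ n) = - P $ n"
      using arg_cong[OF assms(2), of "\<lambda>F. F $ n"] by (simp add: fps_dy_def)
    ultimately show ?case using Suc by (simp del: of_nat_Suc)
  qed (use assms in simp)
  thus ?thesis by (simp add: fps_eq_iff)
qed

text \<open>The difference of the two sides has equal x- and y-derivatives and vanishes at x =
  0.\<close>

lemma in_sum_mult: "in_sum (p * q) = in_sum p * in_sum q"
proof -
  define D where "D p q = in_sum (p * q) - in_sum p * in_sum q" for p q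
  have "fps_deriv (D p q) = fps_dy (D p q)"
    by (simp add: D_def fps_dy_diff fps_dy_mult fps_deriv_in_sum fps_dy_in_sum)
  hence "D p q = 0"
    by (rule fps_dx_eq_dy_imp_0) (simp add: D_def in_sum_nth_0)
  thus ?thesis by (simp add: D_def)
qed

section \<open>The series tan + sec and its differential equations\<close>

definition fps_tan_sec :: "real fps" where
  "fps_tan_sec = fps_tan 1 + inverse (fps_cos 1)"

lemma fps_cos_mult_tan_sec: "fps_cos 1 * fps_tan_sec = 1 + fps_sin 1"
proof -
  have "fps_cos (1::real) $ 0 \<noteq> 0" by simp
  hence "fps_cos 1 * inverse (fps_cos (1::real)) = 1"
    by (metis inverse_mult_eq_1')
  thus ?thesis
    by (simp add: fps_tan_sec_def fps_tan_def fps_divide_unit algebra_simps)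
qed

lemma fps_cos_1_nonzero: "fps_cos (1::real) \<noteq> 0"
  by (metis fps_cos_nth_0 fps_zero_nth zero_neq_one)

lemma fps_deriv_cos_1: "fps_deriv (fps_cos 1) = - fps_sin (1::real)"
  by (simp add: fps_cos_deriv fps_const_neg[symmetric] del: fps_const_neg)

lemma fps_deriv_sin_1: "fps_deriv (fps_sin 1) = fps_cos (1::real)"
  by (simp add: fps_sin_deriv)

text \<open>Differentiating cos E = 1 + sin gives cos E' = cos + sin E. After multiplication by
  cos^2 both sides become polynomials in sin and cos, and the nonzero factor cancels since power
  series form an integral domain.\<close>

lemma fps_deriv_tan_sec: "2 * fps_deriv fps_tan_sec = 1 + fps_tan_sec * fps_tan_sec"
proof -
  let ?y = fps_tan_sec and ?c = "fps_cos (1::real)" and ?s = "fps_sin (1::real)"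
  have d: "?c * fps_deriv ?y - ?s * ?y = ?c"
    using arg_cong[OF fps_cos_mult_tan_sec, of fps_deriv]
    by (simp add: fps_deriv_cos_1 fps_deriv_sin_1)
  have sc: "?c * ?c + ?s * ?s = 1"
    using fps_sin_cos_sum_of_squares[of "1::real"] by (simp add: power2_eq_square)
  have "(?c * ?c) * (2 * fps_deriv ?y) = 2 * ?c * (?c * fps_deriv ?y)"
    by (simp add: algebra_simps)
  also have "\<dots> = 2 * ?c * (?c + ?s * ?y)"
    using d by (simp add: algebra_simps)
  also have "\<dots> = 2 * (?c * ?c) + 2 * ?s * (1 + ?s)"
    by (simp add: fps_cos_mult_tan_sec[symmetric] algebra_simps)
  also have "\<dots> = ?c * ?c + (?c * ?c + ?s * ?s) + 2 * ?s + ?s * ?s"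
    by (simp add: algebra_simps)
  also have "\<dots> = ?c * ?c + (1 + ?s) * (1 + ?s)"
    unfolding sc by (simp add: algebra_simps)
  also have "\<dots> = (?c * ?c) * (1 + ?y * ?y)"
    by (simp add: fps_cos_mult_tan_sec[symmetric] algebra_simps)
  finally show ?thesis using fps_cos_1_nonzero by simp
qed

lemma fps_deriv2_tan_sec:
  "fps_deriv (fps_deriv fps_tan_sec) = fps_tan_sec * fps_deriv fps_tan_sec"
proof -
  have "2 * fps_deriv (fps_deriv fps_tan_sec) = 2 * (fps_tan_sec * fps_deriv fps_tan_sec)"
    using arg_cong[OF fps_deriv_tan_sec, of fps_deriv] by (simp add: algebra_simps)
  thus ?thesis by simp
qed

section \<open>The partial differential equations of F\<close>

definition entringer_fps :: "real fps fps" where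
  "entringer_fps = in_x (fps_cos 1) * in_sum fps_tan_sec - in_x (fps_sin 1)"

lemma in_x_uminus: "in_x (- p) = - in_x p"
  by (simp add: in_x_def fps_eq_iff)

lemmas bivariate_deriv_simps =
  fps_dy_diff fps_dy_add fps_dy_mult fps_dy_in_x fps_dy_in_sum fps_dy_const fps_deriv_in_x fps_deriv_in_sum
  fps_deriv_cos_1 fps_deriv_sin_1 in_x_uminus

lemma entringer_fps_dy: "fps_dy entringer_fps = in_x (fps_cos 1) * in_sum (fps_deriv fps_tan_sec)"
  by (simp add: entringer_fps_def bivariate_deriv_simps)

text \<open>Since E'' = E E', the x-derivative of F_y = cos x E'(x + y) is (cos x E(x + y) - sin x)
  E'(x + y), and the bracket is F. The y-derivative is treated alike in the next lemma.\<close>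

lemma entringer_fps_dx_dy:
  "fps_deriv (fps_dy entringer_fps) = entringer_fps * in_sum (fps_deriv fps_tan_sec)"
  unfolding entringer_fps_dy
  by (simp add: entringer_fps_def bivariate_deriv_simps fps_deriv2_tan_sec in_sum_mult algebra_simps)

lemma entringer_fps_dy_dy:
  "fps_dy (fps_dy entringer_fps) = fps_dy entringer_fps * in_sum fps_tan_sec"
  unfolding entringer_fps_dy
  by (simp add: bivariate_deriv_simps fps_deriv2_tan_sec in_sum_mult algebra_simps)

lemma in_sum_nth_sym: "in_sum p $ i $ j = in_sum p $ j $ i"
proof -
  have "(i + j) choose i = (j + i) choose j"
    using binomial_symmetric[of i "i + j"] by (simp add: add.commute)
  thus ?thesis by (simp add: in_sum_def add.commute)
qed

lemma in_x_nth: "in_x p $ i = fps_const (p $ i)"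
  by (simp add: in_x_def)

lemma in_x_mult_nth: "(in_x p * G) $ i $ j = (\<Sum>k=0..i. p $ k * G $ (i - k) $ j)"
  unfolding fps_mult_nth by (simp add: in_x_def fps_sum_nth)

text \<open>F(y, x) is written out with \<open>fps_const\<close> in place of \<open>in_x\<close>;
  this transposes the coefficients because p(x + y) is symmetric.\<close>

lemma entringer_fps_swap:
  "(fps_const (fps_cos 1) * in_sum fps_tan_sec - fps_const (fps_sin 1)) $ i $ j
     = entringer_fps $ j $ i"
  by (auto simp: entringer_fps_def in_x_mult_nth fps_mult_nth[of "fps_cos 1"] in_x_nth in_sum_nth_sym[of _ i])

text \<open>Since F_x - F_y = -sin x E(x + y) - cos x, the claim amounts to E(x + y) (cos y - sin x)
  = cos x + sin y. \<open>P\<close> is the difference of these two sides and \<open>R\<close> is its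
  derivative along d/dx - d/dy.\<close>

lemma entringer_fps_rotation:
  "fps_deriv entringer_fps - fps_dy entringer_fps
     + (fps_const (fps_cos 1) * in_sum fps_tan_sec - fps_const (fps_sin 1)) = 0"
proof -
  let ?Y = "in_sum fps_tan_sec" and ?c = "fps_cos (1::real)" and ?s = "fps_sin (1::real)"
  define P where "P = ?Y * (fps_const ?c - in_x ?s) - in_x ?c - fps_const ?s"
  define R where "R = ?Y * (fps_const ?s - in_x ?c) + in_x ?s + fps_const ?c"
  have x0: "in_x ?c $ 0 = 1" "in_x ?s $ 0 = 0" by (simp_all add: in_x_def)
  have P0: "P $ 0 = 0"
    using fps_cos_mult_tan_sec by (simp add: P_def x0 in_sum_nth_0 algebra_simps)
  \<comment> \<open>\<open>R $ 0\<close> is E (sin - 1) + cos; multiplied by cos it becomes (1 +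
    sin) (sin - 1) + cos^2 = 0.\<close>
  have "?c * (R $ 0) = (?c * fps_tan_sec) * (?s - 1) + ?c * ?c"
    by (simp add: R_def x0 in_sum_nth_0 algebra_simps)
  also have "\<dots> = (?c * ?c + ?s * ?s) - 1"
    unfolding fps_cos_mult_tan_sec by (simp add: algebra_simps)
  also have "\<dots> = 0"
    using fps_sin_cos_sum_of_squares[of "1::real"] by (simp add: power2_eq_square)
  finally have R0: "R $ 0 = 0" using fps_cos_1_nonzero by simp
  have neg: "fps_const (- p) = - fps_const p" for p :: "real fps" by simp
  have "P = 0"
  proof (rule fps_rotation_imp_0[OF _ _ P0 R0])
    show "fps_deriv P - fps_dy P = R"
      by (simp add: P_def R_def bivariate_deriv_simps neg algebra_simps del: fps_const_neg)
    show "fps_deriv R - fps_dy R = - P"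
      by (simp add: P_def R_def bivariate_deriv_simps neg algebra_simps del: fps_const_neg)
  qed
  thus ?thesis
    by (simp add: P_def entringer_fps_def bivariate_deriv_simps algebra_simps)
qed

text \<open>Indexed by the numbers \<open>a\<close> and \<open>b\<close> of letters smaller and larger than the marked one.\<close>

definition entringer_at :: "nat \<Rightarrow> nat \<Rightarrow> nat" where
  "entringer_at a b = entringer (a + b + 1) (a + 1)"

lemma entringer_at_0_0: "entringer_at 0 0 = 1"
  by (simp add: entringer_at_def entringer.simps)

lemma entringer_at_Suc_0: "entringer_at (Suc a) 0 = 0"
  by (simp add: entringer_at_def entringer.simps)

text \<open>For n = a + b + 2 and m = a + 1, the entry E_(n-1)(n-m) has b smaller and a larger
  letters. This exchange is what produces F(y, x) in the differential equation.\<close>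

lemma entringer_at_Suc: "entringer_at a (Suc b) = entringer_at (Suc a) b + entringer_at b a"
  by (simp add: entringer_at_def entringer.simps[of "Suc (Suc (a + b))" "Suc a"] add.commute)

text \<open>The scaled coefficients \<open>f\<close> have the recurrence and the boundary values of
  \<open>entringer_at\<close>. The recurrence leads from (a, b + 1) to (a + 1, b), with the same sum
  and a smaller second index, and to (b, a), with a smaller sum; hence the nested
  inductions.\<close>

lemma entringer_fps_nth: "entringer_fps $ a $ b = real (entringer_at a b) / (fact a * fact b)"
proof -
  define f where "f a b = fact a * fact b * entringer_fps $ a $ b" for a b
  have f_a_0: "f a 0 = (if a = 0 then 1 else 0)" for a
  proof -
    \<comment> \<open>At y = 0 the series F reduces to cos x E(x) - sin x = 1.\<close>
    have "(in_x (fps_cos 1) * in_sum fps_tan_sec) $ a $ 0 = (fps_cos 1 * fps_tan_sec) $ a"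
      by (simp add: in_x_mult_nth fps_mult_nth[of "fps_cos 1"] in_sum_def)
    also have "\<dots> = (1 + fps_sin 1) $ a" by (simp only: fps_cos_mult_tan_sec)
    finally show ?thesis by (simp add: f_def entringer_fps_def in_x_def)
  qed
  have f_Suc: "f a (Suc b) = f (Suc a) b + f b a" for a b
  proof -
    have "(fps_deriv entringer_fps - fps_dy entringer_fps
      + (fps_const (fps_cos 1) * in_sum fps_tan_sec - fps_const (fps_sin 1))) $ a $ b = 0"
      by (simp only: entringer_fps_rotation fps_zero_nth)
    hence "real (Suc a) * entringer_fps $ Suc a $ b - real (Suc b) * entringer_fps $ a $ Suc b
        + entringer_fps $ b $ a = 0"
      by (simp add: entringer_fps_swap[symmetric] fps_dy_def fps_of_nat[symmetric] del: of_nat_Suc)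
    hence "fact a * fact b * (real (Suc a) * entringer_fps $ Suc a $ b - real (Suc b) * entringer_fps $ a $ Suc b
        + entringer_fps $ b $ a) = 0" by simp
    thus ?thesis by (simp add: f_def algebra_simps)
  qed
  have "real (entringer_at a b) = f a b" for a b
  proof (induction "a + b" arbitrary: a b rule: less_induct)
    case less
    note outer = less
    show ?case using outer
    proof (induction b arbitrary: a)
      case 0
      thus ?case by (cases a) (simp_all add: f_a_0 entringer_at_0_0 entringer_at_Suc_0)
    next
      case (Suc b)
      have "real (entringer_at (Suc a) b) = f (Suc a) b"
        using Suc.prems by (intro Suc.IH) simp
      moreover have "real (entringer_at b a) = f b a"
        using Suc.prems by simp
      ultimately show ?case by (simp add: entringer_at_Suc f_Suc)
    qed
  qed
  thus ?thesis by (simp add: f_def)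
qed

lemma entringer_fps_nth_0: "entringer_fps $ 0 = fps_tan_sec"
  by (simp add: entringer_fps_def in_x_def in_sum_nth_0)

text \<open>Because F(0, y) = E(y), the total E_n is itself the Entringer number E_(n+1)(1), so
  cardinalities can be computed in the naturals.\<close>

lemma tan_sec_number_eq: "tan_sec_number n = real (entringer_at 0 n)"
  using entringer_fps_nth[of 0 n]
  by (simp add: entringer_fps_nth_0 tan_sec_number_def fps_tan_sec_def)

text \<open>The coefficient rule for multiplying an exponential series in x and y by a series in x +
  y: \<open>t\<close> sees only the total size of what is left over.\<close>

definition bconv :: "(nat \<Rightarrow> nat \<Rightarrow> nat) \<Rightarrow> (nat \<Rightarrow> nat) \<Rightarrow> nat \<Rightarrow> nat \<Rightarrow> nat" where
  "bconv f t a b = (\<Sum>i\<le>a. \<Sum>j\<le>b. (a choose i) * (b choose j) * (f i j * t ((a - i) + (b - j))))"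

lemma fps_nth_mult_in_sum:
  assumes "\<And>i j. F $ i $ j = real (f i j) / (fact i * fact j)"
    and "\<And>n. p $ n = real (t n) / fact n"
  shows "(F * in_sum p) $ a $ b = real (bconv f t a b) / (fact a * fact b)"
proof -
  have s: "in_sum p $ i $ j = real (t (i + j)) / (fact i * fact j)" for i j
  proof -
    have "in_sum p $ i $ j = fact (i + j) / (fact i * fact j) * (real (t (i + j)) / fact (i + j))"
      using binomial_fact[of i "i + j", where 'a = real] by (simp add: in_sum_def assms(2))
    thus ?thesis by simp
  qed
  have summand: "real (f i j) / (fact i * fact j) * (real (t (a - i + (b - j))) / (fact (a - i) * fact (b - j)))
    = real ((a choose i) * (b choose j) * (f i j * t (a - i + (b - j)))) / (fact a * fact b)"
    if "i \<le> a" "j \<le> b" for i j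
    using binomial_fact[OF that(1), where 'a = real] binomial_fact[OF that(2), where 'a = real]
    by simp
  have "(F * in_sum p) $ a $ b = (\<Sum>i\<le>a. \<Sum>j\<le>b. F $ i $ j * in_sum p $ (a - i) $ (b - j))"
    by (simp only: fps_mult_nth fps_sum_nth atLeast0AtMost)
  also have "\<dots> = (\<Sum>i\<le>a. \<Sum>j\<le>b. real ((a choose i) * (b choose j) * (f i j * t ((a - i) + (b - j)))) / (fact a * fact b))"
    unfolding s assms(1) by (intro sum.cong refl summand) auto
  also have "\<dots> = real (bconv f t a b) / (fact a * fact b)"
    by (simp only: bconv_def sum_divide_distrib of_nat_sum)
  finally show ?thesis .
qed

lemma fps_tan_sec_nth: "fps_tan_sec $ n = real (entringer_at 0 n) / fact n"
  using entringer_fps_nth[of 0 n] by (simp add: entringer_fps_nth_0)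

lemma fps_deriv_tan_sec_nth: "fps_deriv fps_tan_sec $ n = real (entringer_at 0 (Suc n)) / fact n"
  by (simp add: fps_tan_sec_nth)

lemma entringer_fps_dy_nth:
  "fps_dy entringer_fps $ a $ b = real (entringer_at a (Suc b)) / (fact a * fact b)"
  by (simp add: fps_dy_def entringer_fps_nth divide_simps)

text \<open>Coefficients of F_xy = F E'. Combinatorially, the two letters removed are the minimum
  and the maximum, one on each side of the marked letter.\<close>

lemma entringer_at_Suc_Suc:
  "entringer_at (Suc a) (Suc b) = bconv entringer_at (\<lambda>n. entringer_at 0 (Suc n)) a b"
proof -
  have "fps_deriv (fps_dy entringer_fps) $ a $ b = (entringer_fps * in_sum (fps_deriv fps_tan_sec)) $ a $ b"
    by (simp only: entringer_fps_dx_dy)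
  also have "\<dots> = real (bconv entringer_at (\<lambda>n. entringer_at 0 (Suc n)) a b) / (fact a * fact b)"
    by (intro fps_nth_mult_in_sum entringer_fps_nth fps_deriv_tan_sec_nth)
  finally have "real (Suc a) * (real (entringer_at (Suc a) (Suc b)) / (fact (Suc a) * fact b)) = \<dots>"
    by (simp add: fps_of_nat[symmetric] entringer_fps_dy_nth del: of_nat_Suc fact_Suc)
  thus ?thesis by (simp add: divide_simps del: of_nat_Suc)
qed

lemma entringer_at_Suc2:
  "entringer_at a (Suc (Suc b)) = bconv (\<lambda>i j. entringer_at i (Suc j)) (entringer_at 0) a b"
proof -
  have "fps_dy (fps_dy entringer_fps) $ a $ b = (fps_dy entringer_fps * in_sum fps_tan_sec) $ a $ b"
    by (simp only: entringer_fps_dy_dy)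
  also have "\<dots> = real (bconv (\<lambda>i j. entringer_at i (Suc j)) (entringer_at 0) a b) / (fact a * fact b)"
    by (intro fps_nth_mult_in_sum entringer_fps_dy_nth fps_tan_sec_nth)
  finally have "real (Suc b) * (real (entringer_at a (Suc (Suc b))) / (fact a * fact (Suc b))) = \<dots>"
    by (simp add: fps_dy_def[of "fps_dy entringer_fps"] entringer_fps_dy_nth del: of_nat_Suc fact_Suc)
  thus ?thesis by (simp add: divide_simps del: of_nat_Suc)
qed

section \<open>Subset sums with a marked letter\<close>

definition num_below :: "nat \<Rightarrow> nat set \<Rightarrow> nat" where
  "num_below a Y = card {y \<in> Y. y < a}"

definition num_above :: "nat \<Rightarrow> nat set \<Rightarrow> nat" where
  "num_above a Y = card {y \<in> Y. a < y}"

lemma card_eq_num_below_above: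
  assumes "finite Y" "a \<in> Y"
  shows "card Y = Suc (num_below a Y + num_above a Y)"
proof -
  have "Y = insert a ({y \<in> Y. y < a} \<union> {y \<in> Y. a < y})" using assms by auto
  hence "card Y = card (insert a ({y \<in> Y. y < a} \<union> {y \<in> Y. a < y}))" by (rule arg_cong)
  also have "\<dots> = Suc (card ({y \<in> Y. y < a} \<union> {y \<in> Y. a < y}))" using assms by simp
  also have "card ({y \<in> Y. y < a} \<union> {y \<in> Y. a < y}) = num_below a Y + num_above a Y"
    unfolding num_below_def num_above_def using assms by (intro card_Un_disjoint) auto
  finally show ?thesis .
qed

lemma num_below_insert_less: "finite Y \<Longrightarrow> r \<notin> Y \<Longrightarrow> r < a \<Longrightarrow> num_below a (insert r Y) = Suc (num_below a Y)"
proof -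
  assume *: "finite Y" "r \<notin> Y" "r < a"
  hence "{y \<in> insert r Y. y < a} = insert r {y \<in> Y. y < a}" by auto
  thus ?thesis using * by (simp add: num_below_def)
qed

lemma num_below_insert_ge: "a \<le> r \<Longrightarrow> num_below a (insert r Y) = num_below a Y"
  by (auto simp: num_below_def intro: arg_cong[of _ _ card])

lemma num_above_insert_greater: "finite Y \<Longrightarrow> r \<notin> Y \<Longrightarrow> a < r \<Longrightarrow> num_above a (insert r Y) = Suc (num_above a Y)"
proof -
  assume *: "finite Y" "r \<notin> Y" "a < r"
  hence "{y \<in> insert r Y. a < y} = insert r {y \<in> Y. a < y}" by auto
  thus ?thesis using * by (simp add: num_above_def)
qed

lemma num_above_insert_le: "r \<le> a \<Longrightarrow> num_above a (insert r Y) = num_above a Y"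
  by (auto simp: num_above_def intro: arg_cong[of _ _ card])

lemma sum_Pow_card:
  fixes h :: "nat \<Rightarrow> nat"
  assumes "finite X"
  shows "(\<Sum>S\<in>Pow X. h (card S)) = (\<Sum>i\<le>card X. (card X choose i) * h i)"
proof -
  have "(\<Sum>S\<in>Pow X. h (card S)) = (\<Sum>i\<le>card X. \<Sum>S\<in>{S \<in> Pow X. card S = i}. h (card S))"
    by (rule sum.group[symmetric]) (use assms in \<open>auto intro: card_mono\<close>)
  also have "\<dots> = (\<Sum>i\<le>card X. (card X choose i) * h i)"
    using n_subsets[OF assms] by (intro sum.cong) auto
  finally show ?thesis .
qed

text \<open>A subset containing \<open>a\<close> is a free choice of letters below and of letters
  above \<open>a\<close>, which accounts for the two binomial coefficients; its complement enters
  only through its size.\<close>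

lemma sum_Pow_marked:
  assumes "finite X" "a \<in> X"
  shows "(\<Sum>S\<in>{S \<in> Pow X. a \<in> S}. f (num_below a S) (num_above a S) * t (card X - card S))
           = bconv f t (num_below a X) (num_above a X)"
proof -
  define L G where "L = {y \<in> X. y < a}" and "G = {y \<in> X. a < y}"
  have fin: "finite L" "finite G" using assms by (auto simp: L_def G_def)
  let ?h = "\<lambda>i j. f i j * t ((card L - i) + (card G - j))"
  have "(\<Sum>S\<in>{S \<in> Pow X. a \<in> S}. f (num_below a S) (num_above a S) * t (card X - card S))
      = (\<Sum>(P, Q)\<in>Pow L \<times> Pow G. ?h (card P) (card Q))"
  proof (rule sum.reindex_bij_witness[of _ "\<lambda>(P, Q). insert a (P \<union> Q)" "\<lambda>S. ({y \<in> S. y < a}, {y \<in> S. a < y})"])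
    fix S assume S: "S \<in> {S \<in> Pow X. a \<in> S}"
    hence "finite S" using assms finite_subset by blast
    moreover have "num_below a S \<le> card L" "num_above a S \<le> card G"
      using S fin by (auto simp: L_def G_def num_below_def num_above_def intro!: card_mono)
    ultimately have "card X - card S = (card L - num_below a S) + (card G - num_above a S)"
      using S assms card_eq_num_below_above[of X a] card_eq_num_below_above[of S a]
      by (simp add: L_def G_def num_below_def num_above_def)
    thus "(case ({y \<in> S. y < a}, {y \<in> S. a < y}) of (P, Q) \<Rightarrow> ?h (card P) (card Q))
        = f (num_below a S) (num_above a S) * t (card X - card S)"
      by (simp add: num_below_def num_above_def)
  qed (use assms in \<open>auto simp: L_def G_def\<close>)
  also have "\<dots> = (\<Sum>P\<in>Pow L. \<Sum>Q\<in>Pow G. ?h (card P) (card Q))"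
    by (simp add: sum.cartesian_product)
  also have "\<dots> = (\<Sum>P\<in>Pow L. \<Sum>j\<le>card G. (card G choose j) * ?h (card P) j)"
    by (simp only: sum_Pow_card[OF fin(2), of "?h _"])
  also have "\<dots> = (\<Sum>i\<le>card L. (card L choose i) * (\<Sum>j\<le>card G. (card G choose j) * ?h i j))"
    by (rule sum_Pow_card[OF fin(1)])
  also have "\<dots> = bconv f t (card L) (card G)"
    by (simp add: bconv_def sum_distrib_left mult_ac)
  finally show ?thesis by (simp add: L_def G_def num_below_def num_above_def)
qed

lemma bconv_swap: "bconv (\<lambda>i j. f j i) t b a = bconv f t a b"
  unfolding bconv_def by (subst sum.swap) (simp add: mult_ac add.commute)

text \<open>The case x = 0 of F_yy = F_y E, that is E'' = E' E, which is the recurrence for the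
  number of all Andre words.\<close>

lemma entringer_at_0_Suc2:
  "entringer_at 0 (Suc (Suc b))
     = (\<Sum>j\<le>b. (b choose j) * (entringer_at 0 (Suc j) * entringer_at 0 (b - j)))"
  by (simp add: entringer_at_Suc2 bconv_def)

lemma entringer_at_1: "entringer_at b (Suc 0) = entringer_at 0 b"
  by (simp add: entringer_at_Suc entringer_at_Suc_0)

text \<open>
  Common form of the recurrences for the last three statistics. Deleting the minimum \<open>m\<close>, the mark
  is read off the factor containing the distinguished letter \<open>p\<close>, whose letters are
  \<open>insert p S\<close>; the mark never equals \<open>q Y\<close>, and equals \<open>r\<close> exactly when \<open>S = {}\<close>.
\<close>

lemma marked_count_eq_entringer:
  fixes c :: "nat set \<Rightarrow> nat \<Rightarrow> nat" and q :: "nat set \<Rightarrow> nat"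
  assumes outside: "\<And>Y a. finite Y \<Longrightarrow> card Y \<ge> 2 \<Longrightarrow> a \<notin> Y \<Longrightarrow> c Y a = 0"
    and split: "\<And>Y. finite Y \<Longrightarrow> card Y \<ge> 2 \<Longrightarrow> \<exists>m p r X.
      Y = insert m (insert p X) \<and> m \<noteq> p \<and> m \<notin> X \<and> p \<notin> X \<and> {m, p} = {r, q Y} \<and>
      r \<noteq> q Y \<and> (\<forall>x\<in>X. r < x) \<and> (\<forall>S. S \<subseteq> X \<longrightarrow> S \<noteq> {} \<longrightarrow> q (insert p S) = p) \<and>
      (\<forall>a. c Y a = (\<Sum>S\<in>Pow X. if S = {} then (if a = r then entringer_at 0 (card X) else 0)
                      else c (insert p S) a * entringer_at 0 (card X - card S)))"
    and "finite Y" "card Y \<ge> 2" "a \<in> Y"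
  shows "c Y a = (if a = q Y then 0
                  else entringer_at (num_above a (Y - {q Y})) (Suc (num_below a (Y - {q Y}))))"
  using assms(3-5)
proof (induction "card Y" arbitrary: Y a rule: less_induct)
  case less
  obtain m p r X where
    "Y = insert m (insert p X) \<and> m \<noteq> p \<and> m \<notin> X \<and> p \<notin> X \<and> {m, p} = {r, q Y} \<and>
      r \<noteq> q Y \<and> (\<forall>x\<in>X. r < x) \<and> (\<forall>S. S \<subseteq> X \<longrightarrow> S \<noteq> {} \<longrightarrow> q (insert p S) = p) \<and>
      (\<forall>a. c Y a = (\<Sum>S\<in>Pow X. if S = {} then (if a = r then entringer_at 0 (card X) else 0)
                      else c (insert p S) a * entringer_at 0 (card X - card S)))"
    using split[OF less.prems(1,2)] by (elim exE) (rule that)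
  hence Y: "Y = insert m (insert p X)" "m \<noteq> p" "m \<notin> X" "p \<notin> X"
    and r: "{m, p} = {r, q Y}" "r \<noteq> q Y" "\<And>x. x \<in> X \<Longrightarrow> r < x"
    and q: "\<And>S. S \<subseteq> X \<Longrightarrow> S \<noteq> {} \<Longrightarrow> q (insert p S) = p"
    and c: "\<And>a. c Y a = (\<Sum>S\<in>Pow X. if S = {} then (if a = r then entringer_at 0 (card X) else 0)
                      else c (insert p S) a * entringer_at 0 (card X - card S))"
    by blast+
  have X: "finite X" using less.prems Y by simp
  \<comment> \<open>Removing the excluded value \<open>q Y\<close> leaves \<open>r\<close> and
    \<open>X\<close>. As \<open>r\<close> is below all of \<open>X\<close>, it adds one to the
    letters below any mark in \<open>X\<close>.\<close>
  have rX: "r \<notin> X" "Y - {q Y} = insert r X" using Y r by (auto simp: doubleton_eq_iff)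
  have sub: "finite (insert p S)" "card (insert p S) \<ge> 2" "card (insert p S) < card Y"
    if "S \<subseteq> X" "S \<noteq> {}" for S
  proof -
    have S: "finite S" "p \<notin> S" "m \<notin> S" using that X Y finite_subset by auto
    have "card S \<le> card X" "card S > 0" using that X S by (auto simp: card_mono card_gt_0_iff)
    thus "finite (insert p S)" "card (insert p S) \<ge> 2" "card (insert p S) < card Y"
      using S X Y by auto
  qed
  \<comment> \<open>The letter \<open>m\<close> is absent from the factor, and \<open>p\<close> is
    the excluded value of that factor, so neither is attained there.\<close>
  have mp: "c (insert p S) a = 0" if "S \<subseteq> X" "S \<noteq> {}" "a = m \<or> a = p" for S
    using that(3)
  proof
    assume "a = m"
    thus ?thesis using that sub[OF that(1,2)] Y by (intro outside) auto
  next
    assume "a = p"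
    thus ?thesis using less.hyps[OF sub(3,1,2)[OF that(1,2)], of p] q[OF that(1,2)] by simp
  qed
  show ?case
  proof (cases "a \<in> X")
    case False
    hence a: "a = m \<or> a = p" using less.prems Y by auto
    have "c Y a = (\<Sum>S\<in>Pow X. if S = {} then (if a = r then entringer_at 0 (card X) else 0) else 0)"
      unfolding c by (intro sum.cong refl) (use mp a in auto)
    also have "\<dots> = (if a = r then entringer_at 0 (card X) else 0)"
      using X by simp
    finally have cY: "c Y a = (if a = r then entringer_at 0 (card X) else 0)" .
    show ?thesis
    proof (cases "a = r")
      case True
      have "{y \<in> X. y < r} = {}" "{y \<in> X. r < y} = X" using r(3) by (auto simp: not_less less_imp_le)
      hence "num_below r X = 0" "num_above r X = card X" unfolding num_below_def num_above_def by simp_all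
      thus ?thesis using True cY r(2)
        by (simp add: rX num_below_insert_ge num_above_insert_le entringer_at_1)
    next
      case False
      thus ?thesis using cY a r by (auto simp: doubleton_eq_iff)
    qed
  next
    case True
    hence a: "a \<noteq> m" "a \<noteq> p" "a \<noteq> q Y" "r < a" using Y r by (auto simp: doubleton_eq_iff)
    have "c Y a = (\<Sum>S\<in>Pow X. if a \<in> S then
        entringer_at (num_above a S) (Suc (num_below a S)) * entringer_at 0 (card X - card S) else 0)"
      unfolding c
    proof (intro sum.cong refl)
      fix S assume "S \<in> Pow X"
      hence S: "S \<subseteq> X" by simp
      show "(if S = {} then (if a = r then entringer_at 0 (card X) else 0)
               else c (insert p S) a * entringer_at 0 (card X - card S))
          = (if a \<in> S then entringer_at (num_above a S) (Suc (num_below a S)) * entringer_at 0 (card X - card S) else 0)"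
      proof (cases "S = {}")
        case False
        show ?thesis
        proof (cases "a \<in> S")
          case True
          have "insert p S - {p} = S" using S Y by auto
          thus ?thesis
            using True False less.hyps[OF sub(3,1,2)[OF S False], of a] q[OF S False] a by auto
        next
          case F: False
          thus ?thesis using False outside[OF sub(1,2)[OF S False], of a] a by simp
        qed
      qed (use a in simp)
    qed
    also have "\<dots> = (\<Sum>S\<in>{S \<in> Pow X. a \<in> S}. entringer_at (num_above a S) (Suc (num_below a S)) * entringer_at 0 (card X - card S))"
      using X by (intro sum.inter_filter[symmetric]) simp
    \<comment> \<open>The induction hypothesis counts with the larger letters as first argument of
      \<open>entringer_at\<close>, so the kernel is transposed and \<open>bconv_swap\<close> is
      applied afterwards.\<close>
    also have "\<dots> = bconv (\<lambda>i j. entringer_at j (Suc i)) (entringer_at 0) (num_below a X) (num_above a X)"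
      by (rule sum_Pow_marked[OF X True])
    also have "\<dots> = entringer_at (num_above a X) (Suc (Suc (num_below a X)))"
      by (simp add: entringer_at_Suc2 bconv_swap[of "\<lambda>i j. entringer_at i (Suc j)"])
    finally show ?thesis
      using a X rX by (simp add: num_below_insert_less num_above_insert_le)
  qed
qed

section \<open>Splitting Andre permutations at the minimum\<close>

text \<open>Types I and II differ only in the letter that must accompany the right factor:
  \<open>opt\<close> picks it, as \<open>Max\<close> or \<open>Min\<close>, among the letters other
  than the minimum.\<close>

locale andre =
  fixes A :: "nat list \<Rightarrow> bool" and opt :: "nat set \<Rightarrow> nat"
  assumes A_Nil: "A []" and A_single: "A [x]"
    and A_step: "\<lbrakk>distinct w; length w \<ge> 2; w = v @ Min (set w) # v'; A v; A v';
      opt (set (v @ v')) \<in> set v'\<rbrakk> \<Longrightarrow> A w"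
    and A_cases: "\<lbrakk>A w; length w \<ge> 2\<rbrakk> \<Longrightarrow>
      \<exists>v v'. w = v @ Min (set w) # v' \<and> A v \<and> A v' \<and> opt (set (v @ v')) \<in> set v'"
    and opt_in: "\<lbrakk>finite Z; Z \<noteq> {}\<rbrakk> \<Longrightarrow> opt Z \<in> Z"
begin

definition words :: "nat set \<Rightarrow> nat list set" where
  "words Y = {w \<in> permutations_of_set Y. A w}"

lemma words_set: "w \<in> words Y \<Longrightarrow> set w = Y"
  and words_distinct: "w \<in> words Y \<Longrightarrow> distinct w"
  and words_A: "w \<in> words Y \<Longrightarrow> A w"
  by (auto simp: words_def permutations_of_set_def)

lemma words_length: "w \<in> words Y \<Longrightarrow> length w = card Y"
  by (metis words_set words_distinct distinct_card)

lemma finite_words: "finite (words Y)"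
  unfolding words_def by simp

lemma words_empty: "words {} = {[]}"
  by (auto simp: words_def A_Nil)

lemma words_single: "words {x} = {[x]}"
  by (auto simp: words_def A_single)

lemma min_opt_decomposition:
  assumes "finite Y" "card Y \<ge> 2"
  defines "m \<equiv> Min Y"
  defines "X \<equiv> Y - {m, opt (Y - {m})}"
  shows "m \<in> Y" "opt (Y - {m}) \<in> Y - {m}" "card Y = Suc (Suc (card X))" "finite X"
proof -
  show m: "m \<in> Y" using assms by (auto simp: m_def intro!: Min_in)
  hence "card (Y - {m}) \<noteq> 0" using assms(1,2) by simp
  hence "Y - {m} \<noteq> {}" by (metis card.empty)
  thus p: "opt (Y - {m}) \<in> Y - {m}" using assms(1) by (intro opt_in) auto
  have "X = Y - {m} - {opt (Y - {m})}" unfolding X_def by auto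
  thus "card Y = Suc (Suc (card X))" "finite X"
    using p m assms(1) card_Suc_Diff1[OF assms(1) m] card_Suc_Diff1[of "Y - {m}" "opt (Y - {m})"]
    by auto
qed

text \<open>Only the letter set S of the left factor is restricted: it avoids the minimum and the
  letter forced to the right. The factors are then independent Andre words.\<close>

lemma words_split:
  assumes "finite Y" "card Y \<ge> 2"
  defines "m \<equiv> Min Y"
  shows "words Y = (\<lambda>(S, v, v'). v @ m # v') `
    (SIGMA S:Pow (Y - {m, opt (Y - {m})}). words S \<times> words (Y - {m} - S))"
proof (intro equalityI subsetI)
  fix w assume w: "w \<in> words Y"
  hence ws: "set w = Y" "distinct w" "A w" "length w \<ge> 2"
    using words_set words_distinct words_A words_length assms by auto
  then obtain v v' where v: "w = v @ m # v'" "A v" "A v'" "opt (set (v @ v')) \<in> set v'"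
    using A_cases unfolding m_def by blast
  have Y: "Y = insert m (set v \<union> set v')" using v ws by auto
  have d: "m \<notin> set v" "m \<notin> set v'" "set v \<inter> set v' = {}" "distinct v" "distinct v'"
    using ws v(1) by auto
  have 1: "Y - {m} = set (v @ v')" using Y d by auto
  have 2: "Y - {m} - set v = set v'" using Y d by auto
  have "set v \<in> Pow (Y - {m, opt (Y - {m})})"
    using v(4) d Y unfolding 1 by auto
  moreover have "v \<in> words (set v)" "v' \<in> words (Y - {m} - set v)"
    unfolding 2 using d v by (auto simp: words_def permutations_of_set_def)
  ultimately show "w \<in> (\<lambda>(S, v, v'). v @ m # v') `
    (SIGMA S:Pow (Y - {m, opt (Y - {m})}). words S \<times> words (Y - {m} - S))"
    using v(1) by (intro image_eqI[of _ _ "(set v, v, v')"]) auto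
next
  fix w assume "w \<in> (\<lambda>(S, v, v'). v @ m # v') `
    (SIGMA S:Pow (Y - {m, opt (Y - {m})}). words S \<times> words (Y - {m} - S))"
  then obtain S v v' where w: "w = v @ m # v'" and S: "S \<subseteq> Y - {m, opt (Y - {m})}"
    and v: "v \<in> words S" "v' \<in> words (Y - {m} - S)" by auto
  have m: "m \<in> Y" and p: "opt (Y - {m}) \<in> Y - {m}"
    using min_opt_decomposition[OF assms(1,2)] by (simp_all add: m_def)
  have s: "set v = S" "set v' = Y - {m} - S" using v words_set by auto
  have Y: "set w = Y" using s S m w by auto
  have 1: "set (v @ v') = Y - {m}" using s S by auto
  have dw: "distinct w" using words_distinct[OF v(1)] words_distinct[OF v(2)] s S w by auto
  have o: "opt (set (v @ v')) \<in> set v'" unfolding 1 using s S p by auto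
  have l: "length w \<ge> 2" using assms Y dw distinct_card by metis
  have "A w"
    using A_step[OF dw l _ words_A[OF v(1)] words_A[OF v(2)] o] w Y by (simp add: m_def)
  thus "w \<in> words Y" using dw Y by (auto simp: words_def permutations_of_set_def)
qed

lemma card_words_split:
  assumes "finite Y" "card Y \<ge> 2"
  defines "m \<equiv> Min Y"
  shows "card {w \<in> words Y. P w} = (\<Sum>S\<in>Pow (Y - {m, opt (Y - {m})}).
    card {(v, v') \<in> words S \<times> words (Y - {m} - S). P (v @ m # v')})"
proof -
  let ?D = "SIGMA S:Pow (Y - {m, opt (Y - {m})}). {(v, v') \<in> words S \<times> words (Y - {m} - S). P (v @ m # v')}"
  have "inj_on (\<lambda>(S, v, v'). v @ m # v') ?D"
  proof (rule inj_onI, clarsimp, goal_cases)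
    case (1 S v v' S' u u')
    have s: "set v = S" "set v' = Y - {m} - S" "set u = S'" using 1 words_set by blast+
    hence "m \<notin> set v" "m \<notin> set v'" using 1 by auto
    hence "v = u \<and> v' = u'" using 1 by (simp add: append_Cons_eq_iff)
    thus ?case using s by simp
  qed
  moreover have "{w \<in> words Y. P w} = (\<lambda>(S, v, v'). v @ m # v') ` ?D"
    unfolding words_split[OF assms(1,2)] m_def[symmetric] by (auto simp: image_iff) blast
  ultimately have "card {w \<in> words Y. P w} = card ?D" by (simp add: card_image)
  also have "\<dots> = (\<Sum>S\<in>Pow (Y - {m, opt (Y - {m})}).
    card {(v, v') \<in> words S \<times> words (Y - {m} - S). P (v @ m # v')})"
    using assms by (intro card_SigmaI) (auto intro!: finite_subset[OF _ finite_cartesian_product[OF finite_words finite_words]])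
  finally show ?thesis .
qed

text \<open>If k letters remain besides the minimum and the forced one, a left factor of size i
  leaves k - i + 1 letters on the right. This is E'' = E' E, whatever \<open>opt\<close> is.\<close>

lemma card_words:
  assumes "finite Y"
  shows "card (words Y) = entringer_at 0 (card Y)"
  using assms
proof (induction "card Y" arbitrary: Y rule: less_induct)
  case less
  consider "card Y = 0" | "card Y = 1" | "card Y \<ge> 2" by linarith
  thus ?case
  proof cases
    case 1
    thus ?thesis using less by (simp add: words_empty entringer_at_0_0)
  next
    case 2
    then obtain x where "Y = {x}" by (auto simp: card_1_singleton_iff)
    thus ?thesis by (simp add: words_single entringer_at_1 entringer_at_0_0)
  next
    case 3
    define m X where "m = Min Y" and "X = Y - {m, opt (Y - {m})}"
    have m: "m \<in> Y" and cX: "card Y = Suc (Suc (card X))" "finite X"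
      using min_opt_decomposition[OF less.prems 3] by (simp_all add: m_def X_def)
    have "card (words Y) = card {w \<in> words Y. True}" by simp
    also have "\<dots> = (\<Sum>S\<in>Pow X. card (words S \<times> words (Y - {m} - S)))"
      unfolding card_words_split[OF less.prems 3] m_def X_def
      by (intro sum.cong refl arg_cong[of _ _ card]) auto
    also have "\<dots> = (\<Sum>S\<in>Pow X. entringer_at 0 (card S) * entringer_at 0 (Suc (card X - card S)))"
    proof (intro sum.cong refl)
      fix S assume "S \<in> Pow X"
      hence S: "S \<subseteq> X" "finite S" using cX finite_subset by auto
      hence le: "card S \<le> card X" using cX by (simp add: card_mono)
      have "S \<subseteq> Y - {m}" using S X_def by auto
      hence cV: "card (Y - {m} - S) = Suc (card X - card S)"
        using S cX m less.prems le by (simp add: card_Diff_subset Suc_diff_le)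
      have "card (words S) = entringer_at 0 (card S)"
        using less.hyps S le cX by simp
      moreover have "card (words (Y - {m} - S)) = entringer_at 0 (Suc (card X - card S))"
        using less.hyps[of "Y - {m} - S"] less.prems cV cX by simp
      ultimately show "card (words S \<times> words (Y - {m} - S))
          = entringer_at 0 (card S) * entringer_at 0 (Suc (card X - card S))"
        by (simp add: card_cartesian_product)
    qed
    also have "\<dots> = (\<Sum>i\<le>card X. (card X choose i) * (entringer_at 0 i * entringer_at 0 (Suc (card X - i))))"
      by (rule sum_Pow_card[OF cX(2)])
    also have "\<dots> = (\<Sum>j\<le>card X. (card X choose j) * (entringer_at 0 (Suc j) * entringer_at 0 (card X - j)))"
      by (rule sum.reindex_bij_witness[of _ "\<lambda>i. card X - i" "\<lambda>i. card X - i"])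
         (auto simp: binomial_symmetric[symmetric])
    also have "\<dots> = entringer_at 0 (card Y)"
      by (simp add: entringer_at_0_Suc2 cX)
    finally show ?thesis .
  qed
qed

end

lemma card_pairs_fst: "card {(v, v') \<in> V \<times> V'. Q v} = card {v \<in> V. Q v} * card V'"
proof -
  have "{(v, v') \<in> V \<times> V'. Q v} = {v \<in> V. Q v} \<times> V'" by auto
  thus ?thesis by (simp add: card_cartesian_product)
qed

lemma card_pairs_snd: "card {(v, v') \<in> V \<times> V'. Q v'} = card V * card {v' \<in> V'. Q v'}"
proof -
  have "{(v, v') \<in> V \<times> V'. Q v'} = V \<times> {v' \<in> V'. Q v'}" by auto
  thus ?thesis by (simp add: card_cartesian_product)
qed

context andre
begin

text \<open>For a statistic read off the right factor, the sum is indexed by the letters S that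
  accompany the forced letter \<open>p\<close> there; the left factor on \<open>X - S\<close>
  contributes only its number of words.\<close>

lemma card_words_split_right:
  assumes "finite Y" "card Y \<ge> 2"
  defines "m \<equiv> Min Y"
  defines "p \<equiv> opt (Y - {m})"
  defines "X \<equiv> Y - {m, p}"
  assumes R: "\<And>v v'. v' \<noteq> [] \<Longrightarrow> P (v @ m # v') = R v'"
  shows "card {w \<in> words Y. P w} =
    (\<Sum>S\<in>Pow X. card {v' \<in> words (insert p S). R v'} * entringer_at 0 (card X - card S))"
proof -
  note dec = min_opt_decomposition[OF assms(1,2), folded m_def, folded p_def, folded X_def]
  have "card {w \<in> words Y. P w} =
      (\<Sum>S\<in>Pow X. card {(v, v') \<in> words S \<times> words (Y - {m} - S). P (v @ m # v')})"
    unfolding card_words_split[OF assms(1,2)] m_def p_def X_def ..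
  also have "\<dots> = (\<Sum>S\<in>Pow X. card {(v, v') \<in> words (X - S) \<times> words (Y - {m} - (X - S)). P (v @ m # v')})"
    by (rule sum.reindex_bij_witness[of _ "\<lambda>S. X - S" "\<lambda>S. X - S"]) (auto simp: double_diff)
  also have "\<dots> = (\<Sum>S\<in>Pow X. card {v' \<in> words (insert p S). R v'} * entringer_at 0 (card X - card S))"
  proof (intro sum.cong refl)
    fix S assume "S \<in> Pow X"
    hence S: "S \<subseteq> X" by simp
    have V: "Y - {m} - (X - S) = insert p S" using S dec(1,2) by (auto simp: X_def)
    have "v' \<noteq> []" if "v' \<in> words (insert p S)" for v'
      using words_set[OF that] by auto
    hence "{(v, v') \<in> words (X - S) \<times> words (insert p S). P (v @ m # v')}
        = {(v, v') \<in> words (X - S) \<times> words (insert p S). R v'}"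
      using R by auto
    hence "card {(v, v') \<in> words (X - S) \<times> words (insert p S). P (v @ m # v')}
        = card (words (X - S)) * card {v' \<in> words (insert p S). R v'}"
      by (simp only: card_pairs_snd)
    moreover have "card (words (X - S)) = entringer_at 0 (card X - card S)"
      using card_words[of "X - S"] dec(4) S by (simp add: card_Diff_subset finite_subset)
    ultimately show "card {(v, v') \<in> words (X - S) \<times> words (Y - {m} - (X - S)). P (v @ m # v')}
        = card {v' \<in> words (insert p S). R v'} * entringer_at 0 (card X - card S)"
      by (simp add: V)
  qed
  finally show ?thesis .
qed

end

section \<open>First, next to last and last letter\<close>

interpretation I: andre andreI Max
proof
  fix w assume "andreI w" "length w \<ge> 2"
  thus "\<exists>v v'. w = v @ Min (set w) # v' \<and> andreI v \<and> andreI v' \<and> Max (set (v @ v')) \<in> set v'"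
    by (cases rule: andreI.cases) (simp_all, blast)
qed (use andreI.intros in auto)

interpretation II: andre andreII Min
proof
  fix w assume "andreII w" "length w \<ge> 2"
  thus "\<exists>v v'. w = v @ Min (set w) # v' \<and> andreII v \<and> andreII v' \<and> Min (set (v @ v')) \<in> set v'"
    by (cases rule: andreII.cases) (simp_all, blast)
qed (use andreII.intros in auto)

lemma Min_less_rest:
  fixes Y :: "nat set"
  assumes "finite Y" "y \<in> Y - {Min Y}"
  shows "Min Y < y"
  using assms by (metis DiffE Min_le insertI1 le_neq_implies_less)

lemma Max_Diff_Min:
  fixes Y :: "nat set"
  assumes "finite Y" "card Y \<ge> 2"
  shows "Max (Y - {Min Y}) = Max Y" "Max Y \<noteq> Min Y"
proof -
  have d: "Max (Y - {Min Y}) \<in> Y - {Min Y}"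
    using I.min_opt_decomposition(2)[OF assms] .
  show "Max (Y - {Min Y}) = Max Y"
  proof (rule Max_eqI[symmetric])
    fix y assume y: "y \<in> Y"
    show "y \<le> Max (Y - {Min Y})"
    proof (cases "y = Min Y")
      case True
      thus ?thesis using Min_less_rest[OF assms(1) d] by simp
    next
      case False
      thus ?thesis using y assms by simp
    qed
  qed (use assms d in auto)
  thus "Max Y \<noteq> Min Y" using d by auto
qed

lemma next_to_last_append:
  assumes "v' \<noteq> []"
  shows "next_to_last (v @ m # v') = (if length v' = 1 then m else next_to_last v')"
proof (cases "length v' = 1")
  case True
  thus ?thesis by (auto simp: next_to_last_def letter_def length_Suc_conv nth_append)
next
  case False
  hence "length v' \<ge> 2" using assms by (cases v') (auto simp: Suc_le_eq)
  then obtain k where "length v' = k + 2" by (metis add.commute le_Suc_ex)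
  thus ?thesis by (auto simp: next_to_last_def letter_def nth_append nth_Cons')
qed

lemma next_to_last_in_set: "length w \<ge> 2 \<Longrightarrow> next_to_last w \<in> set w"
  by (auto simp: next_to_last_def letter_def)

lemma last_letter_eq_last: "w \<noteq> [] \<Longrightarrow> last_letter w = last w"
  by (cases w rule: rev_cases) (auto simp: last_letter_def letter_def)

lemma first_letter_eq_hd: "w \<noteq> [] \<Longrightarrow> first_letter w = hd w"
  by (cases w) (auto simp: first_letter_def letter_def)

text \<open>The right factor always holds the maximum. If it is alone there, \<open>m\<close> is
  next to last; otherwise the statistic is that of the right factor. Thus p is the maximum and r is
  \<open>m\<close>.\<close>

lemma card_next_to_last:
  assumes "finite Y" "card Y \<ge> 2" "a \<in> Y"
  shows "card {w \<in> I.words Y. next_to_last w = a} = (if a = Max Y then 0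
                  else entringer_at (num_above a (Y - {Max Y})) (Suc (num_below a (Y - {Max Y}))))"
proof (rule marked_count_eq_entringer[where c = "\<lambda>Y a. card {w \<in> I.words Y. next_to_last w = a}" and q = Max, OF _ _ assms])
  fix Y :: "nat set" and a assume *: "finite Y" "card Y \<ge> 2" "a \<notin> Y"
  have "{w \<in> I.words Y. next_to_last w = a} = {}"
    using * next_to_last_in_set I.words_set I.words_length by fastforce
  thus "card {w \<in> I.words Y. next_to_last w = a} = 0" by (simp only: card.empty)
next
  fix Y :: "nat set" assume Y: "finite Y" "card Y \<ge> 2"
  define m p X where "m = Min Y" and "p = Max Y" and "X = Y - {m, p}"
  have mp: "Max (Y - {m}) = p" "p \<noteq> m" using Max_Diff_Min[OF Y] by (simp_all add: m_def p_def)
  have dec: "m \<in> Y" "p \<in> Y" "finite X"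
    using I.min_opt_decomposition(1,2)[OF Y, folded m_def] Y by (auto simp: mp X_def)
  have rec: "card {w \<in> I.words Y. next_to_last w = a} =
      (\<Sum>S\<in>Pow X. if S = {} then (if a = m then entringer_at 0 (card X) else 0)
        else card {w \<in> I.words (insert p S). next_to_last w = a} * entringer_at 0 (card X - card S))" for a
  proof -
    have "card {w \<in> I.words Y. next_to_last w = a} = (\<Sum>S\<in>Pow X.
        card {v' \<in> I.words (insert p S). (if length v' = 1 then m else next_to_last v') = a} * entringer_at 0 (card X - card S))"
      using I.card_words_split_right[OF Y, of "\<lambda>w. next_to_last w = a"
        "\<lambda>v'. (if length v' = 1 then m else next_to_last v') = a", folded m_def]
      by (simp add: mp X_def[symmetric] next_to_last_append)
    also have "\<dots> = (\<Sum>S\<in>Pow X. if S = {} then (if a = m then entringer_at 0 (card X) else 0)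
        else card {w \<in> I.words (insert p S). next_to_last w = a} * entringer_at 0 (card X - card S))"
    proof (intro sum.cong refl)
      fix S assume "S \<in> Pow X"
      hence S: "finite S" "p \<notin> S" using dec finite_subset by (auto simp: X_def)
      show "card {v' \<in> I.words (insert p S). (if length v' = 1 then m else next_to_last v') = a} * entringer_at 0 (card X - card S)
        = (if S = {} then (if a = m then entringer_at 0 (card X) else 0)
        else card {w \<in> I.words (insert p S). next_to_last w = a} * entringer_at 0 (card X - card S))"
      proof (cases "S = {}")
        case True
        thus ?thesis by (auto simp: I.words_single Collect_conv_if)
      next
        case False
        hence "length v' \<noteq> 1" if "v' \<in> I.words (insert p S)" for v'
          using I.words_length[OF that] S by simp
        hence "{v' \<in> I.words (insert p S). (if length v' = 1 then m else next_to_last v') = a}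
           = {w \<in> I.words (insert p S). next_to_last w = a}" by auto
        thus ?thesis using False by simp
      qed
    qed
    finally show ?thesis .
  qed
  have "\<forall>S. S \<subseteq> X \<longrightarrow> S \<noteq> {} \<longrightarrow> Max (insert p S) = p"
    using Y dec(3) by (intro allI impI Max_eqI) (auto simp: X_def p_def intro: finite_subset)
  have "\<forall>x\<in>X. m < x"
    using Min_less_rest[OF Y(1)] by (auto simp: X_def m_def)
  have "Y = insert m (insert p X)" using dec by (auto simp: X_def)
  have "m \<noteq> p" "m \<notin> X" "p \<notin> X" "{m, p} = {m, Max Y}" "m \<noteq> Max Y"
    using mp(2) by (auto simp: X_def p_def)
  show "\<exists>m p r X.
      Y = insert m (insert p X) \<and> m \<noteq> p \<and> m \<notin> X \<and> p \<notin> X \<and> {m, p} = {r, Max Y} \<and>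
      r \<noteq> Max Y \<and> (\<forall>x\<in>X. r < x) \<and> (\<forall>S. S \<subseteq> X \<longrightarrow> S \<noteq> {} \<longrightarrow> Max (insert p S) = p) \<and>
      (\<forall>a. card {w \<in> I.words Y. next_to_last w = a} =
        (\<Sum>S\<in>Pow X. if S = {} then (if a = r then entringer_at 0 (card X) else 0)
          else card {w \<in> I.words (insert p S). next_to_last w = a} * entringer_at 0 (card X - card S)))"
    by (rule exI[of _ m], rule exI[of _ p], rule exI[of _ m], rule exI[of _ X])
       (intro conjI; (fact | simp add: rec))
qed

text \<open>The forced letter \<open>p\<close> is the second smallest and becomes the minimum of the
  right factor, so it ends the word only when alone there. Thus r is \<open>p\<close> and the
  excluded value is \<open>m\<close>.\<close>

lemma card_last_letter:
  assumes "finite Y" "card Y \<ge> 2" "a \<in> Y"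
  shows "card {w \<in> II.words Y. last_letter w = a} = (if a = Min Y then 0
                  else entringer_at (num_above a (Y - {Min Y})) (Suc (num_below a (Y - {Min Y}))))"
proof (rule marked_count_eq_entringer[where c = "\<lambda>Y a. card {w \<in> II.words Y. last_letter w = a}" and q = Min, OF _ _ assms])
  fix Y :: "nat set" and a assume *: "finite Y" "card Y \<ge> 2" "a \<notin> Y"
  have "last_letter w \<in> Y" if "w \<in> II.words Y" for w
  proof -
    have "w \<noteq> []" using II.words_length[OF that] * by auto
    thus ?thesis using II.words_set[OF that] by (auto simp: last_letter_eq_last)
  qed
  hence "{w \<in> II.words Y. last_letter w = a} = {}" using * by auto
  thus "card {w \<in> II.words Y. last_letter w = a} = 0" by (simp only: card.empty)
next
  fix Y :: "nat set" assume Y: "finite Y" "card Y \<ge> 2"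
  define m where "m = Min Y"
  define p where "p = Min (Y - {m})"
  define X where "X = Y - {m, p}"
  note dec = II.min_opt_decomposition[OF Y, folded m_def, folded p_def, folded X_def]
  have pX: "p < x" if "x \<in> X" for x
    using Min_less_rest[of "Y - {m}" x] Y that unfolding X_def p_def by blast
  have rec: "card {w \<in> II.words Y. last_letter w = a} =
      (\<Sum>S\<in>Pow X. if S = {} then (if a = p then entringer_at 0 (card X) else 0)
        else card {w \<in> II.words (insert p S). last_letter w = a} * entringer_at 0 (card X - card S))" for a
  proof -
    have "card {w \<in> II.words Y. last_letter w = a} = (\<Sum>S\<in>Pow X.
        card {v' \<in> II.words (insert p S). last_letter v' = a} * entringer_at 0 (card X - card S))"
      unfolding X_def p_def m_def
      by (rule II.card_words_split_right[OF Y]) (simp add: last_letter_eq_last)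
    also have "\<dots> = (\<Sum>S\<in>Pow X. if S = {} then (if a = p then entringer_at 0 (card X) else 0)
        else card {w \<in> II.words (insert p S). last_letter w = a} * entringer_at 0 (card X - card S))"
      by (intro sum.cong refl) (auto simp: II.words_single Collect_conv_if last_letter_eq_last)
    finally show ?thesis .
  qed
  have "\<forall>S. S \<subseteq> X \<longrightarrow> S \<noteq> {} \<longrightarrow> Min (insert p S) = p"
    using dec(4) pX by (intro allI impI Min_eqI) (auto intro: finite_subset less_imp_le)
  have "Y = insert m (insert p X)" using dec by (auto simp: X_def)
  have "m \<noteq> p" "m \<notin> X" "p \<notin> X" "{m, p} = {p, Min Y}" "p \<noteq> Min Y" "\<forall>x\<in>X. p < x"
    using dec(2) pX by (auto simp: X_def m_def)
  show "\<exists>m p r X.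
      Y = insert m (insert p X) \<and> m \<noteq> p \<and> m \<notin> X \<and> p \<notin> X \<and> {m, p} = {r, Min Y} \<and>
      r \<noteq> Min Y \<and> (\<forall>x\<in>X. r < x) \<and> (\<forall>S. S \<subseteq> X \<longrightarrow> S \<noteq> {} \<longrightarrow> Min (insert p S) = p) \<and>
      (\<forall>a. card {w \<in> II.words Y. last_letter w = a} =
        (\<Sum>S\<in>Pow X. if S = {} then (if a = r then entringer_at 0 (card X) else 0)
          else card {w \<in> II.words (insert p S). last_letter w = a} * entringer_at 0 (card X - card S)))"
    by (rule exI[of _ m], rule exI[of _ p], rule exI[of _ p], rule exI[of _ X])
       (intro conjI; (fact | simp add: rec))
qed

text \<open>Unless it is the minimum, the first letter is that of the left factor. The right factor
  holds the maximum besides \<open>X - S\<close>, which gives the weight E' and the convolution for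
  F_xy.\<close>

lemma card_first_letter:
  assumes "finite Y" "a \<in> Y"
  shows "card {w \<in> I.words Y. first_letter w = a} = entringer_at (num_below a Y) (num_above a Y)"
  using assms
proof (induction "card Y" arbitrary: Y a rule: less_induct)
  case less
  show ?case
  proof (cases "card Y \<ge> 2")
    case False
    hence "card Y = 1" using less.prems by (cases "card Y") auto
    hence "Y = {a}" using less.prems by (auto simp: card_1_singleton_iff)
    thus ?thesis
      by (simp add: I.words_single Collect_conv_if first_letter_eq_hd num_below_def num_above_def entringer_at_0_0)
  next
    case True
    define m p X where "m = Min Y" and "p = Max Y" and "X = Y - {m, p}"
    have mp: "Max (Y - {m}) = p" "p \<noteq> m"
      using Max_Diff_Min[OF less.prems(1) True] by (simp_all add: m_def p_def)
    note dec = I.min_opt_decomposition[OF less.prems(1) True, folded m_def, unfolded mp, folded X_def]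
    have Y: "Y = insert m (insert p X)" "m \<notin> X" "p \<notin> X" using dec by (auto simp: X_def)
    have m: "m < x" if "x \<in> insert p X" for x
      using Min_less_rest[OF less.prems(1), of x, folded m_def] that Y mp by auto
    have p: "x < p" if "x \<in> X" for x
      using Max_ge[OF less.prems(1), of x, folded p_def] that Y by (metis insertCI le_neq_implies_less)
    have split: "card {w \<in> I.words Y. first_letter w = a} =
        (\<Sum>S\<in>Pow X. card {(v, v') \<in> I.words S \<times> I.words (Y - {m} - S). first_letter (v @ m # v') = a})"
      using I.card_words_split[OF less.prems(1) True] by (simp add: m_def[symmetric] mp X_def)
    have cV: "card (I.words (Y - {m} - S)) = entringer_at 0 (Suc (card X - card S))" if "S \<subseteq> X" for S
    proof -
      have "finite S" "S \<subseteq> Y - {m}" using that dec(4) finite_subset Y by auto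
      hence "card (Y - {m} - S) = Suc (card X - card S)"
        using dec that by (simp add: card_Diff_subset Suc_diff_le card_mono)
      thus ?thesis using I.card_words[of "Y - {m} - S"] less.prems by simp
    qed
    show ?thesis
    proof (cases "a = m")
      case True
      have "card {w \<in> I.words Y. first_letter w = a} =
          (\<Sum>S\<in>Pow X. if S = {} then entringer_at 0 (Suc (card X)) else 0)"
        unfolding split
      proof (intro sum.cong refl)
        fix S assume "S \<in> Pow X"
        hence S: "S \<subseteq> X" by simp
        show "card {(v, v') \<in> I.words S \<times> I.words (Y - {m} - S). first_letter (v @ m # v') = a}
            = (if S = {} then entringer_at 0 (Suc (card X)) else 0)"
        proof (cases "S = {}")
          case T: True
          have "{(v, v') \<in> I.words S \<times> I.words (Y - {m} - S). first_letter (v @ m # v') = a}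
              = {[]} \<times> I.words (Y - {m} - S)"
            using T True by (auto simp: I.words_empty first_letter_eq_hd)
          thus ?thesis using cV[OF S] T by (simp add: card_cartesian_product)
        next
          case False
          have "first_letter (v @ m # v') \<noteq> a" if "v \<in> I.words S" for v v'
          proof -
            have "v \<noteq> []" using I.words_set[OF that] False by auto
            hence "first_letter (v @ m # v') \<in> S" using I.words_set[OF that] by (auto simp: first_letter_eq_hd)
            thus ?thesis using S Y True by auto
          qed
          hence "{(v, v') \<in> I.words S \<times> I.words (Y - {m} - S). first_letter (v @ m # v') = a} = {}" by auto
          thus ?thesis using False by (simp only: card.empty if_False)
        qed
      qed
      also have "\<dots> = entringer_at 0 (Suc (card X))" using dec by simp
      finally have "card {w \<in> I.words Y. first_letter w = a} = entringer_at 0 (Suc (card X))" .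
      moreover have "{y \<in> Y. y < a} = {}" using m Y True by (force dest: less_asym)
      hence "num_below a Y = 0" by (simp only: num_below_def card.empty)
      moreover have "num_above a Y = Suc (card X)"
        using card_eq_num_below_above[OF less.prems] dec(3) \<open>num_below a Y = 0\<close> by simp
      ultimately show ?thesis by simp
    next
      case False
      have "card {w \<in> I.words Y. first_letter w = a} =
          (\<Sum>S\<in>Pow X. if a \<in> S then entringer_at (num_below a S) (num_above a S) * entringer_at 0 (Suc (card X - card S)) else 0)"
        unfolding split
      proof (intro sum.cong refl)
        fix S assume "S \<in> Pow X"
        hence S: "S \<subseteq> X" "finite S" using dec(4) finite_subset by auto
        have fl: "first_letter (v @ m # v') = a \<longleftrightarrow> a \<in> S \<and> first_letter v = a" if "v \<in> I.words S" for v v'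
        proof (cases "v = []")
          case T: True
          hence "S = {}" using I.words_set[OF that] by simp
          thus ?thesis using T False by (simp add: first_letter_eq_hd)
        next
          case F: False
          thus ?thesis using I.words_set[OF that] by (auto simp: first_letter_eq_hd)
        qed
        have "{(v, v') \<in> I.words S \<times> I.words (Y - {m} - S). first_letter (v @ m # v') = a}
          = {(v, v') \<in> I.words S \<times> I.words (Y - {m} - S). a \<in> S \<and> first_letter v = a}"
          using fl by auto
        hence eq: "card {(v, v') \<in> I.words S \<times> I.words (Y - {m} - S). first_letter (v @ m # v') = a}
          = card {v \<in> I.words S. a \<in> S \<and> first_letter v = a} * entringer_at 0 (Suc (card X - card S))"
          by (simp only: card_pairs_fst cV[OF S(1)])
        have "card S < card Y" using card_mono[OF dec(4) S(1)] dec(3) by simp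
        thus "card {(v, v') \<in> I.words S \<times> I.words (Y - {m} - S). first_letter (v @ m # v') = a}
          = (if a \<in> S then entringer_at (num_below a S) (num_above a S) * entringer_at 0 (Suc (card X - card S)) else 0)"
          unfolding eq using less.hyps[of S a] S by auto
      qed
      also have "\<dots> = (\<Sum>S\<in>{S \<in> Pow X. a \<in> S}. entringer_at (num_below a S) (num_above a S) * entringer_at 0 (Suc (card X - card S)))"
        using dec by (intro sum.inter_filter[symmetric]) simp
      finally have c: "card {w \<in> I.words Y. first_letter w = a} = \<dots>" .
      show ?thesis
      proof (cases "a = p")
        case True
        \<comment> \<open>The maximum never lies in the left factor: the sum is empty, in agreement
          with E_n(n) = 0.\<close>
        have "m \<in> {y \<in> Y. y < a}" using True Y m by auto
        hence "num_below a Y \<noteq> 0" using less.prems by (auto simp: num_below_def)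
        then obtain k where k: "num_below a Y = Suc k" using not0_implies_Suc by blast
        have "{y \<in> Y. a < y} = {}" using True Y p m by (auto dest: less_asym)
        hence "num_above a Y = 0" unfolding num_above_def by (simp only: card.empty)
        moreover have "{S \<in> Pow X. a \<in> S} = {}" using True Y by auto
        ultimately show ?thesis unfolding c k by (simp only: sum.empty entringer_at_Suc_0)
      next
        case Fp: False
        hence a: "a \<in> X" "m < a" "a < p" using False less.prems Y m p by auto
        have b: "num_below a Y = Suc (num_below a X)" "num_above a Y = Suc (num_above a X)"
          using a Y dec(4) mp
          by (simp_all add: num_below_insert_less num_below_insert_ge num_above_insert_greater num_above_insert_le)
        show ?thesis unfolding c b entringer_at_Suc_Suc
          using sum_Pow_marked[OF dec(4) a(1), of entringer_at "\<lambda>n. entringer_at 0 (Suc n)"] by (simp only:)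
      qed
    qed
  qed
qed

section \<open>The greater neighbour of the maximum\<close>

lemma grn_append:
  assumes "distinct (u @ M # u')" "\<And>x. x \<in> set (u @ u') \<Longrightarrow> x < M"
  shows "grn (u @ M # u') = max (if u = [] then 0 else last u) (if u' = [] then 0 else hd u')"
proof -
  let ?w = "u @ M # u'"
  have M: "Max (set ?w) = M" using assms(2) by (intro Max_eqI) (auto intro: less_imp_le)
  have "(THE i. i \<in> {1..length ?w} \<and> letter ?w i = Max (set ?w)) = Suc (length u)"
    unfolding M
  proof (rule the_equality)
    fix i assume i: "i \<in> {1..length ?w} \<and> letter ?w i = M"
    hence "?w ! (i - 1) = ?w ! length u" by (auto simp: letter_def)
    moreover have "i - 1 < length ?w" "length u < length ?w" using i by auto
    ultimately have "i - 1 = length u" using nth_eq_iff_index_eq[OF assms(1)] by blast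
    thus "i = Suc (length u)" using i by auto
  qed (simp add: letter_def)
  moreover have "letter ?w (Suc (length u) - 1) = (if u = [] then 0 else last u)"
    by (auto simp: letter_def nth_append last_conv_nth Suc_le_eq)
  moreover have "letter ?w (Suc (length u) + 1) = (if u' = [] then 0 else hd u')"
    by (auto simp: letter_def nth_append hd_conv_nth Suc_le_eq)
  ultimately show ?thesis by (simp add: grn_def Let_def)
qed

lemma grn_in_set:
  assumes "distinct w" "length w \<ge> 2"
  shows "grn w \<in> set w"
proof -
  have "w \<noteq> []" using assms by auto
  hence "Max (set w) \<in> set w" by simp
  then obtain u u' where w: "w = u @ Max (set w) # u'" by (auto dest: split_list)
  define M where "M = Max (set w)"
  have w': "w = u @ M # u'" using w by (simp add: M_def)
  have "x < M" if "x \<in> set (u @ u')" for x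
  proof -
    have "x \<le> M" unfolding M_def using that w' by (intro Max_ge) auto
    moreover have "x \<noteq> M" using that w' assms(1) by auto
    ultimately show ?thesis by simp
  qed
  hence "grn w = max (if u = [] then 0 else last u) (if u' = [] then 0 else hd u')"
    using grn_append[of u M u'] assms(1) w' by simp
  moreover have "u \<noteq> [] \<or> u' \<noteq> []" using assms(2) w' by auto
  moreover have "u \<noteq> [] \<Longrightarrow> last u \<in> set w" "u' \<noteq> [] \<Longrightarrow> hd u' \<in> set w"
    using w' by simp_all
  ultimately show ?thesis by (simp add: max_def split: if_splits)
qed

text \<open>Appending \<open>m\<close> changes a neighbour of M only if M ends \<open>v\<close>,
  where \<open>m\<close> replaces the boundary value 0. Being smaller than every other letter,
  \<open>m\<close> matters only if M has no other neighbour.\<close>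

lemma grn_append_left:
  assumes "distinct (v @ m # v')" "M \<in> set v" "\<And>x. x \<in> set (v @ m # v') \<Longrightarrow> x \<le> M"
    "\<And>x. x \<in> set (v @ v') \<Longrightarrow> m < x"
  shows "grn (v @ m # v') = (if length v = 1 then m else grn v)"
proof -
  obtain u u' where v: "v = u @ M # u'" using assms(2) by (auto dest: split_list)
  have lt: "x < M" if "x \<in> set (u @ u' @ m # v')" for x
    using assms(3)[of x] assms(1) that v by (cases "x = M") auto
  have "grn (u @ M # (u' @ m # v')) = max (if u = [] then 0 else last u) (hd (u' @ m # v'))"
    using grn_append[of u M "u' @ m # v'"] assms(1) v lt by simp
  moreover have "grn v = max (if u = [] then 0 else last u) (if u' = [] then 0 else hd u')"
    unfolding v using assms(1) v lt by (intro grn_append) auto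
  moreover have "m < last u" if "u \<noteq> []" using assms(4) v that by simp
  ultimately show ?thesis
    using v by (auto simp: hd_append max_def)
qed

lemma grn_append_right:
  assumes "distinct (v @ m # v')" "M \<in> set v'" "\<And>x. x \<in> set (v @ m # v') \<Longrightarrow> x \<le> M"
    "\<And>x. x \<in> set (v @ v') \<Longrightarrow> m < x"
  shows "grn (v @ m # v') = (if length v' = 1 then m else grn v')"
proof -
  obtain u u' where v': "v' = u @ M # u'" using assms(2) by (auto dest: split_list)
  have lt: "x < M" if "x \<in> set (v @ m # u @ u')" for x
    using assms(3)[of x] assms(1) that v' by (cases "x = M") auto
  have "grn ((v @ m # u) @ M # u') = max (last (m # u)) (if u' = [] then 0 else hd u')"
    using grn_append[of "v @ m # u" M u'] assms(1) v' lt by simp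
  moreover have "grn v' = max (if u = [] then 0 else last u) (if u' = [] then 0 else hd u')"
    unfolding v' using assms(1) v' lt by (intro grn_append) auto
  moreover have "m < hd u'" if "u' \<noteq> []" using assms(4) v' that by simp
  ultimately show ?thesis
    using v' by (cases "u = []"; cases "u' = []") (auto simp: max_def)
qed

text \<open>Once the letters S sharing the factor of the maximum are fixed, the position of
  \<open>z\<close> decides which side that factor is on. Both sides have the same weight, as the
  other factor is counted by size alone, so the recurrence has the common form with p = M and r =
  m.\<close>

lemma card_grn:
  assumes "finite Y" "card Y \<ge> 2" "a \<in> Y"
  shows "card {w \<in> II.words Y. grn w = a} = (if a = Max Y then 0
                  else entringer_at (num_above a (Y - {Max Y})) (Suc (num_below a (Y - {Max Y}))))"
proof (rule marked_count_eq_entringer[where c = "\<lambda>Y a. card {w \<in> II.words Y. grn w = a}" and q = Max, OF _ _ assms])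
  fix Y :: "nat set" and a assume *: "finite Y" "card Y \<ge> 2" "a \<notin> Y"
  have "grn w \<in> Y" if "w \<in> II.words Y" for w
    using grn_in_set[of w] II.words_set[OF that] II.words_distinct[OF that] II.words_length[OF that] * by simp
  hence "{w \<in> II.words Y. grn w = a} = {}" using * by auto
  thus "card {w \<in> II.words Y. grn w = a} = 0" by (simp only: card.empty)
next
  fix Y :: "nat set" assume Y: "finite Y" "card Y \<ge> 2"
  define m M where "m = Min Y" and "M = Max Y"
  define z where "z = Min (Y - {m})"
  define X where "X = Y - {m, M}"
  have mM: "M \<noteq> m" using Max_Diff_Min(2)[OF Y] by (simp add: m_def M_def)
  note dec = II.min_opt_decomposition[OF Y, folded m_def, folded z_def]
  have M: "M \<in> Y" "\<And>y. y \<in> Y \<Longrightarrow> y \<le> M" using Y dec(1) by (auto simp: M_def intro!: Max_in)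
  have m: "m < y" if "y \<in> Y" "y \<noteq> m" for y
    using Min_less_rest[OF Y(1), of y] that by (auto simp: m_def)
  have YX: "Y = insert m (insert M X)" "m \<notin> X" "M \<notin> X" "finite X"
    using dec(1) M Y by (auto simp: X_def)
  \<comment> \<open>Equality of \<open>z\<close> and \<open>M\<close> occurs only for two letters,
    when \<open>X\<close> is empty.\<close>
  have zX: "z \<in> X" if "z \<noteq> M" using that dec(2) YX by auto
  have cut: "card {w \<in> II.words (insert M S). (if length w = 1 then m else grn w) = a} * entringer_at 0 (card X - card S)
      = (if S = {} then (if a = m then entringer_at 0 (card X) else 0)
         else card {w \<in> II.words (insert M S). grn w = a} * entringer_at 0 (card X - card S))"
    if "S \<subseteq> X" for S a
  proof (cases "S = {}")
    case True
    thus ?thesis by (auto simp: II.words_single Collect_conv_if)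
  next
    case False
    have "finite S" "M \<notin> S" using that YX finite_subset by auto
    hence "length w \<noteq> 1" if "w \<in> II.words (insert M S)" for w
      using II.words_length[OF that] False by simp
    hence "{w \<in> II.words (insert M S). (if length w = 1 then m else grn w) = a}
       = {w \<in> II.words (insert M S). grn w = a}" by auto
    thus ?thesis using False by simp
  qed
  have rec: "card {w \<in> II.words Y. grn w = a} =
      (\<Sum>S\<in>Pow X. if S = {} then (if a = m then entringer_at 0 (card X) else 0)
        else card {w \<in> II.words (insert M S). grn w = a} * entringer_at 0 (card X - card S))" for a
  proof -
    let ?N = "\<lambda>S. card {(v, v') \<in> II.words S \<times> II.words (Y - {m} - S). grn (v @ m # v') = a}"
    let ?T = "\<lambda>S. card {w \<in> II.words (insert M S). (if length w = 1 then m else grn w) = a} * entringer_at 0 (card X - card S)"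
    have words: "distinct (v @ m # v')" "\<And>x. x \<in> set (v @ m # v') \<Longrightarrow> x \<le> M"
      "\<And>x. x \<in> set (v @ v') \<Longrightarrow> m < x"
      if "S \<subseteq> Y - {m}" "v \<in> II.words S" "v' \<in> II.words (Y - {m} - S)" for S v v'
    proof -
      have s: "set v = S" "set v' = Y - {m} - S" "distinct v" "distinct v'"
        using that II.words_set II.words_distinct by auto
      thus "distinct (v @ m # v')" using that by auto
      show "\<And>x. x \<in> set (v @ m # v') \<Longrightarrow> x \<le> M" using s that M(2) dec(1) by auto
      show "\<And>x. x \<in> set (v @ v') \<Longrightarrow> m < x" using s that m by auto
    qed
    have left: "?N (insert M S) = ?T S" if S: "S \<subseteq> X" for S
    proof -
      let ?V = "Y - {m} - insert M S"
      have SY: "insert M S \<subseteq> Y - {m}" using S YX mM by auto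
      have "grn (v @ m # v') = (if length v = 1 then m else grn v)"
        if "v \<in> II.words (insert M S)" "v' \<in> II.words ?V" for v v'
        by (rule grn_append_left[OF words(1)[OF SY that] _ words(2,3)[OF SY that]])
           (simp_all add: II.words_set[OF that(1)])
      hence "{(v, v') \<in> II.words (insert M S) \<times> II.words ?V. grn (v @ m # v') = a}
          = {(v, v') \<in> II.words (insert M S) \<times> II.words ?V. (if length v = 1 then m else grn v) = a}"
        by auto
      hence "?N (insert M S) = card {v \<in> II.words (insert M S). (if length v = 1 then m else grn v) = a} * card (II.words ?V)"
        by (simp only: card_pairs_fst)
      moreover have "?V = X - S" using YX by auto
      hence "card (II.words ?V) = entringer_at 0 (card X - card S)"
        using II.card_words[of "X - S"] YX S by (simp add: card_Diff_subset finite_subset)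
      ultimately show ?thesis by simp
    qed
    have right: "?N (X - S) = ?T S" if S: "S \<subseteq> X" for S
    proof -
      let ?V = "Y - {m} - (X - S)"
      have SY: "X - S \<subseteq> Y - {m}" using S YX by auto
      have V: "?V = insert M S" using S YX mM by auto
      have "grn (v @ m # v') = (if length v' = 1 then m else grn v')"
        if "v \<in> II.words (X - S)" "v' \<in> II.words ?V" for v v'
        by (rule grn_append_right[OF words(1)[OF SY that] _ words(2,3)[OF SY that]])
           (simp_all add: II.words_set[OF that(2)] V)
      hence "{(v, v') \<in> II.words (X - S) \<times> II.words ?V. grn (v @ m # v') = a}
          = {(v, v') \<in> II.words (X - S) \<times> II.words ?V. (if length v' = 1 then m else grn v') = a}"
        by auto
      hence "?N (X - S) = card (II.words (X - S)) * card {v \<in> II.words ?V. (if length v = 1 then m else grn v) = a}"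
        by (simp only: card_pairs_snd)
      moreover have "card (II.words (X - S)) = entringer_at 0 (card X - card S)"
        using II.card_words[of "X - S"] YX S by (simp add: card_Diff_subset finite_subset)
      ultimately show ?thesis by (simp add: V)
    qed
    have "card {w \<in> II.words Y. grn w = a} = (\<Sum>S\<in>Pow (Y - {m, z}). ?N S)"
      unfolding II.card_words_split[OF Y] m_def z_def ..
    also have "\<dots> = (\<Sum>S\<in>Pow X. ?T S)"
      \<comment> \<open>Index by the letters accompanying \<open>M\<close> in its factor; that factor is the right one iff it contains \<open>z\<close>.\<close>
    proof (rule sum.reindex_bij_witness[of _ "\<lambda>S. if z \<in> S \<or> z = M then X - S else insert M S"
          "\<lambda>S. if M \<in> S then S - {M} else X - S"])
      fix S assume S: "S \<in> Pow (Y - {m, z})"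
      show "?T (if M \<in> S then S - {M} else X - S) = ?N S"
      proof (cases "M \<in> S")
        case True
        hence "S - {M} \<subseteq> X" "insert M (S - {M}) = S" using S YX by auto
        thus ?thesis using left[of "S - {M}"] True by simp
      next
        case False
        hence "S \<subseteq> X" using S YX by auto
        hence "X - (X - S) = S" by auto
        thus ?thesis using right[of "X - S"] False by simp
      qed
    qed (use YX zX mM in auto)
    also have "\<dots> = (\<Sum>S\<in>Pow X. if S = {} then (if a = m then entringer_at 0 (card X) else 0)
        else card {w \<in> II.words (insert M S). grn w = a} * entringer_at 0 (card X - card S))"
      by (intro sum.cong refl cut) simp
    finally show ?thesis .
  qed
  have "\<forall>S. S \<subseteq> X \<longrightarrow> S \<noteq> {} \<longrightarrow> Max (insert M S) = M"
    using M YX by (intro allI impI Max_eqI) (auto intro: finite_subset)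
  have "\<forall>x\<in>X. m < x" using m YX by auto
  have "m \<noteq> M" "{m, M} = {m, Max Y}" "m \<noteq> Max Y"
    using mM by (auto simp: M_def)
  show "\<exists>m p r X.
      Y = insert m (insert p X) \<and> m \<noteq> p \<and> m \<notin> X \<and> p \<notin> X \<and> {m, p} = {r, Max Y} \<and>
      r \<noteq> Max Y \<and> (\<forall>x\<in>X. r < x) \<and> (\<forall>S. S \<subseteq> X \<longrightarrow> S \<noteq> {} \<longrightarrow> Max (insert p S) = p) \<and>
      (\<forall>a. card {w \<in> II.words Y. grn w = a} =
        (\<Sum>S\<in>Pow X. if S = {} then (if a = r then entringer_at 0 (card X) else 0)
          else card {w \<in> II.words (insert p S). grn w = a} * entringer_at 0 (card X - card S)))"
    by (rule exI[of _ m], rule exI[of _ M], rule exI[of _ m], rule exI[of _ X])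
       (intro conjI; (fact | simp add: rec))
qed

section \<open>Equidistribution on intervals\<close>

lemma AndI_eq: "AndI n = I.words {1..n}"
  by (simp add: AndI_def I.words_def)

lemma AndII_eq: "AndII n = II.words {1..n}"
  by (simp add: AndII_def II.words_def)

lemma num_below_interval: "a \<in> {1..n} \<Longrightarrow> num_below a {1..n} = a - 1"
proof -
  assume "a \<in> {1..n}"
  hence "{y \<in> {1..n}. y < a} = {1..<a}" by auto
  thus ?thesis by (simp add: num_below_def)
qed

lemma num_above_interval: "a \<in> {1..n} \<Longrightarrow> num_above a {1..n} = n - a"
proof -
  assume "a \<in> {1..n}"
  hence "{y \<in> {1..n}. a < y} = {a<..n}" by auto
  thus ?thesis by (simp add: num_above_def)
qed

lemma marked_interval_without_max:
  assumes "n \<ge> 2" "a \<in> {1..n}"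
  shows "(if a = Max {1..n} then 0
          else entringer_at (num_above a ({1..n} - {Max {1..n}})) (Suc (num_below a ({1..n} - {Max {1..n}}))))
         = (if a = n then 0 else entringer n (n - a))"
proof -
  have M: "Max {1..n} = n" using assms by (intro Max_eqI) auto
  have i: "{1..n} - {n} = {1..n - 1}" by auto
  show ?thesis
  proof (cases "a = n")
    case False
    \<comment> \<open>There are n - 1 - a letters above and a - 1 below; the extra
      \<open>Suc\<close> restores the total n and the mark is n - a.\<close>
    hence "a \<in> {1..n - 1}" using assms by auto
    thus ?thesis
      unfolding M i num_below_interval[OF \<open>a \<in> {1..n - 1}\<close>] num_above_interval[OF \<open>a \<in> {1..n - 1}\<close>]
      using False by (auto simp: entringer_at_def intro!: arg_cong2[of _ _ _ _ entringer])
  qed (simp only: M simp_thms if_True)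
qed

lemma marked_interval_without_min:
  assumes "n \<ge> 2" "a \<in> {1..n}"
  shows "(if a = Min {1..n} then 0
          else entringer_at (num_above a ({1..n} - {Min {1..n}})) (Suc (num_below a ({1..n} - {Min {1..n}}))))
         = (if a = 1 then 0 else entringer n (Suc n - a))"
proof -
  have m: "Min {1..n} = 1" using assms by (intro Min_eqI) auto
  have i: "{1..n} - {1} = {2..n}" by auto
  show ?thesis
  proof (cases "a = 1")
    case False
    \<comment> \<open>The interval starts at 2, so only a - 2 letters are below, and the mark
      becomes n + 1 - a.\<close>
    hence "{y \<in> {2..n}. y < a} = {2..<a}" "{y \<in> {2..n}. a < y} = {a<..n}" using assms by auto
    hence "num_below a {2..n} = a - 2" "num_above a {2..n} = n - a"
      unfolding num_below_def num_above_def by simp_all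
    moreover have "n - a + Suc (a - 2) + 1 = n" "n - a + 1 = Suc n - a" using assms False by auto
    ultimately show ?thesis unfolding m i entringer_at_def using False by (simp only: if_False)
  qed (simp only: m simp_thms if_True)
qed

theorem theorem1p1:
  fixes n :: nat
  assumes "n \<ge> 2"
  shows "entringerian n (AndI n) (\<lambda>w. int (first_letter w)) \<and>
         entringerian n (AndI n) (\<lambda>w. int n - int (next_to_last w)) \<and>
         entringerian n (AndII n) (\<lambda>w. int (n + 1) - int (last_letter w)) \<and>
         entringerian n (AndII n) (\<lambda>w. int n - int (grn w))"
proof -
  have total: "real (card (AndI n)) = tan_sec_number n" "real (card (AndII n)) = tan_sec_number n"
    using I.card_words[of "{1..n}"] II.card_words[of "{1..n}"]
    by (simp_all add: AndI_eq AndII_eq tan_sec_number_eq)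
  have Y: "finite {1..n}" "card {1..n} \<ge> 2" using assms by auto
  have complement: "card {w \<in> W. int n - int (s w) = int m} = entringer n m"
    if "\<And>a. a \<in> {1..n} \<Longrightarrow> card {w \<in> W. s w = a} = (if a = n then 0 else entringer n (n - a))"
      and "\<And>w. w \<in> W \<Longrightarrow> s w \<in> {1..n}" and m: "m \<in> {1..n}"
    for W :: "nat list set" and s :: "nat list \<Rightarrow> nat" and m
  proof (cases "m = n")
    case True
    \<comment> \<open>The value m = n would require the statistic to be 0, which is not a letter;
      this matches E_n(n) = 0.\<close>
    hence "{w \<in> W. int n - int (s w) = int m} = {}" using that(2) by fastforce
    thus ?thesis using True entringer_diag[OF assms] by (simp only: card.empty)
  next
    case False
    hence "{w \<in> W. int n - int (s w) = int m} = {w \<in> W. s w = n - m}" using m by auto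
    thus ?thesis using that(1)[of "n - m"] m False by auto
  qed
  show ?thesis unfolding entringerian_def
  proof (intro conjI ballI total)
    fix m assume m: "m \<in> {1..n}"
    show "card {w \<in> AndI n. int (first_letter w) = int m} = entringer n m"
      using card_first_letter[OF Y(1) m, unfolded num_below_interval[OF m] num_above_interval[OF m]] m
      by (simp add: AndI_eq entringer_at_def)
    show "card {w \<in> AndI n. int n - int (next_to_last w) = int m} = entringer n m"
    proof (rule complement[OF _ _ m])
      fix w assume "w \<in> AndI n"
      thus "next_to_last w \<in> {1..n}"
        using next_to_last_in_set[of w] I.words_set[of w] I.words_length[of w] assms by (simp add: AndI_eq)
    qed (unfold AndI_eq, subst card_next_to_last[OF Y], simp, rule marked_interval_without_max[OF assms])
    show "card {w \<in> AndII n. int n - int (grn w) = int m} = entringer n m"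
    proof (rule complement[OF _ _ m])
      fix w assume "w \<in> AndII n"
      thus "grn w \<in> {1..n}"
        using grn_in_set[of w] II.words_set[of w] II.words_length[of w] II.words_distinct[of w] assms
        by (simp add: AndII_eq)
    qed (unfold AndII_eq, subst card_grn[OF Y], simp, rule marked_interval_without_max[OF assms])
    \<comment> \<open>Here m = n corresponds to the excluded last letter 1, again matching E_n(n) =
      0.\<close>
    have "{w \<in> AndII n. int (n + 1) - int (last_letter w) = int m} = {w \<in> AndII n. last_letter w = n + 1 - m}"
      using m by auto
    moreover have "n + 1 - m \<in> {1..n}" using m by auto
    ultimately show "card {w \<in> AndII n. int (n + 1) - int (last_letter w) = int m} = entringer n m"
      using card_last_letter[OF Y, of "n + 1 - m", unfolded marked_interval_without_min[OF assms \<open>n + 1 - m \<in> {1..n}\<close>]] m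
        entringer_diag[OF assms]
      by (cases "m = n") (auto simp: AndII_eq)
  qed
qed

end
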